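(* Let $f_1\in\mathbb{C}[x_1,\dots,x_n]$ be a homogeneous polynomial of degree $d>n\ge3$ having an isolated singularity at $0$. Put $w_i:=\tfrac1d$ for all $i$ and $\widetilde{\alpha}_f:=\tfrac nd$. Then, with $\alpha=1$: (i) there is a monomial $f_{>1}$ of (usual) degree $2d-n+1$ such that $f:=f_1+f_{>1}$ satisfies $\alpha<\widetilde{\alpha}_f+\rho_f-1$, where $\rho_f=\tfrac{2d-n+1}{d}>1$ is the weighted degree of $f_{>1}$; (ii) there is a monomial $f_{>1}$ of (usual) degree $2d-n$ such that for $f:=f_1+f_{>1}$, with $\rho_f=\tfrac{2d-n}{d}>1$ the weighted degree of $f_{>1}$ and $r=1$, there is $h\in V^{\alpha+r-r\rho_f}\mathbb{C}\{x\}$ such that the image of $f_{>1}^{\,r}h$ in $\mathrm{Gr}_V^{\alpha+r}\bigl(\mathbb{C}\{x\}/(\partial f)\bigr)$ does not vanish.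
   Context: $V^\gamma\mathbb{C}\{x\}$ ($\gamma\in\mathbb{Q}$) is the ideal of $\mathbb{C}\{x\}=\mathbb{C}\{x_1,\dots,x_n\}$ generated by the monomials $x^\nu$ whose shifted weighted degree $\sum_iw_i(\nu_i+1)$ (here $=\frac{1}{d}(n+\sum_i\nu_i)$) is at least $\gamma$. On $\mathbb{C}\{x\}/(\partial f)$, where $(\partial f)=(\partial_{x_1}f,\dots,\partial_{x_n}f)$ is the Jacobian ideal, $V$ is the quotient filtration, and $\mathrm{Gr}_V^\gamma=V^\gamma/V^{>\gamma}$. The weighted degree of a monomial $x^\nu$ is $\sum_iw_i\nu_i$, so $f_1$ has weighted degree $1$. *)

theory Defs
  imports
    "HOL-Algebra.QuotRing"
    "HOL-Analysis.Finite_Cartesian_Product"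
    "HOL-Analysis.Infinite_Sum"
    "HOL-Analysis.Elementary_Metric_Spaces"
    "HOL-Library.Poly_Mapping"
begin

text \<open>
  The variables $x_1,\dots,x_n$ are indexed by a finite type \<open>'n\<close> with \<open>n = CARD('n)\<close>.
  A monomial $x^\nu$ is given by its exponent vector \<open>\<nu> :: nat ^ 'n\<close>, a formal power series by its
  coefficient function on exponent vectors, and a polynomial by a finitely supported one, i.e. by an
  element \<open>p\<close> of \<open>(nat ^ 'n) \<Rightarrow>\<^sub>0 complex\<close>; \<open>Poly_Mapping.lookup p\<close> is then \<open>p\<close> regarded as a power series.
\<close>

type_synonym 'n mpowser = "nat ^ 'n \<Rightarrow> complex"

definition mdeg :: "nat ^ 'n::finite \<Rightarrow> nat"
  where "mdeg \<nu> = (\<Sum>i\<in>UNIV. \<nu> $ i)"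

definition wdeg :: "('n \<Rightarrow> rat) \<Rightarrow> nat ^ 'n::finite \<Rightarrow> rat"
  where "wdeg w \<nu> = (\<Sum>i\<in>UNIV. w i * of_nat (\<nu> $ i))"

definition shifted_wdeg :: "('n \<Rightarrow> rat) \<Rightarrow> nat ^ 'n::finite \<Rightarrow> rat"
  where "shifted_wdeg w \<nu> = (\<Sum>i\<in>UNIV. w i * (of_nat (\<nu> $ i) + 1))"

definition homogeneous :: "nat \<Rightarrow> (nat ^ 'n::finite \<Rightarrow>\<^sub>0 complex) \<Rightarrow> bool"
  where "homogeneous d p \<longleftrightarrow> (\<forall>\<nu>\<in>Poly_Mapping.keys p. mdeg \<nu> = d)"

definition xmonom :: "nat ^ 'n::finite \<Rightarrow> 'n mpowser"
  where "xmonom \<nu> = (\<lambda>\<mu>. if \<mu> = \<nu> then 1 else 0)"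

definition partial_deriv :: "'n \<Rightarrow> 'n mpowser \<Rightarrow> ('n::finite) mpowser"
  where "partial_deriv i a = (\<lambda>\<nu>. of_nat (\<nu> $ i + 1) * a (\<nu> + axis i 1))"

definition mpowser_mult :: "'n mpowser \<Rightarrow> 'n mpowser \<Rightarrow> ('n::finite) mpowser"
  where "mpowser_mult a b = (\<lambda>\<nu>. \<Sum>(\<mu>, \<kappa>) \<in> {(\<mu>, \<kappa>). \<mu> + \<kappa> = \<nu>}. a \<mu> * b \<kappa>)"

text \<open>Convergent means absolutely convergent on some polydisc around the origin.\<close>

definition convergent_mpowser :: "('n::finite) mpowser \<Rightarrow> bool"
  where "convergent_mpowser a \<longleftrightarrow>
    (\<exists>s::real. s > 0 \<and> (\<lambda>\<nu>. norm (a \<nu>) * s ^ mdeg \<nu>) summable_on UNIV)"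

definition conv_mpowser_ring :: "(('n::finite) mpowser) ring"  (\<open>\<C>{x}\<close>)
  where "conv_mpowser_ring =
    \<lparr>carrier = {a. convergent_mpowser a}, monoid.mult = mpowser_mult, one = xmonom 0,
     zero = (\<lambda>\<nu>. 0), add = (\<lambda>a b \<nu>. a \<nu> + b \<nu>)\<rparr>"

abbreviation exponent_pairs :: "nat ^ 'n::finite \<Rightarrow> ((nat ^ 'n) \<times> (nat ^ 'n)) set"
  where "exponent_pairs \<nu> \<equiv> {(\<mu>, \<kappa>). \<mu> + \<kappa> = \<nu>}"

lemma finite_exponents_le: "finite {\<mu>::nat ^ 'n::finite. \<forall>i. \<mu> $ i \<le> \<nu> $ i}"
proof -
  have "finite (vec_nth ` {\<mu>::nat ^ 'n::finite. \<forall>i. \<mu> $ i \<le> \<nu> $ i})"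
    by (rule finite_subset[of _ "PiE UNIV (\<lambda>i. {..\<nu> $ i})"]) (auto intro!: finite_PiE)
  thus ?thesis by (rule finite_imageD) (auto simp: inj_on_def vec_eq_iff)
qed

lemma finite_exponent_pairs: "finite (exponent_pairs \<nu>)"
  by (rule finite_subset[OF _ finite_cartesian_product[OF finite_exponents_le[of \<nu>] finite_exponents_le[of \<nu>]]]) auto

lemma mdeg_add: "mdeg (\<mu> + \<kappa>) = mdeg \<mu> + mdeg \<kappa>"
  by (simp add: mdeg_def sum.distrib)

lemma mpowser_mult_commute: "mpowser_mult a b = mpowser_mult b a"
  unfolding mpowser_mult_def
  by (rule ext, rule sum.reindex_bij_witness[of _ prod.swap prod.swap]) (auto simp: add.commute)

lemma mpowser_mult_assoc: "mpowser_mult (mpowser_mult a b) c = mpowser_mult a (mpowser_mult b c)"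
proof
  fix \<nu>
  let ?f = "\<lambda>(x, y, z). a x * b y * c z"
  have "mpowser_mult (mpowser_mult a b) c \<nu> =
    (\<Sum>p\<in>exponent_pairs \<nu>. \<Sum>q\<in>exponent_pairs (fst p). a (fst q) * b (snd q) * c (snd p))"
    by (simp add: mpowser_mult_def sum_distrib_right case_prod_unfold)
  also have "\<dots> = (\<Sum>(p,q)\<in>Sigma (exponent_pairs \<nu>) (\<lambda>p. exponent_pairs (fst p)). a (fst q) * b (snd q) * c (snd p))"
    by (rule sum.Sigma) (auto simp: finite_exponent_pairs)
  also have "\<dots> = (\<Sum>(p,q)\<in>Sigma (exponent_pairs \<nu>) (\<lambda>p. exponent_pairs (snd p)). a (fst p) * (b (fst q) * c (snd q)))"
    by (rule sum.reindex_bij_witness[of _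
        "\<lambda>(p,q). ((fst p + fst q, snd q), (fst p, fst q))"
        "\<lambda>(p,q). ((fst q, snd q + snd p), (snd q, snd p))"]) (auto simp: add.assoc mult.assoc)
  also have "\<dots> = (\<Sum>p\<in>exponent_pairs \<nu>. \<Sum>q\<in>exponent_pairs (snd p). a (fst p) * (b (fst q) * c (snd q)))"
    by (rule sum.Sigma[symmetric]) (auto simp: finite_exponent_pairs)
  also have "\<dots> = mpowser_mult a (mpowser_mult b c) \<nu>"
    by (simp add: mpowser_mult_def sum_distrib_left case_prod_unfold)
  finally show "mpowser_mult (mpowser_mult a b) c \<nu> = mpowser_mult a (mpowser_mult b c) \<nu>" .
qed

lemma mpowser_mult_xmonom_0: fixes a :: "('n::finite) mpowser" shows "mpowser_mult (xmonom 0) a = a"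
proof
  fix \<nu> :: "nat ^ 'n"
  have "mpowser_mult (xmonom 0) a \<nu> = (\<Sum>p\<in>{(0::nat^'n,\<nu>)}. xmonom 0 (fst p) * a (snd p))"
    unfolding mpowser_mult_def case_prod_unfold
    by (rule sum.mono_neutral_right) (use finite_exponent_pairs[of \<nu>] in \<open>auto simp: xmonom_def case_prod_unfold prod_eq_iff\<close>)
  thus "mpowser_mult (xmonom 0) a \<nu> = a \<nu>" by (simp add: xmonom_def)
qed

lemma convergent_mpowser_mono:
  assumes "(\<lambda>\<nu>. norm (a \<nu>) * s ^ mdeg \<nu>) summable_on UNIV" "0 < t" "t \<le> (s::real)"
  shows "(\<lambda>\<nu>. norm (a \<nu>) * t ^ mdeg \<nu>) summable_on UNIV"
  by (rule summable_on_comparison_test[OF assms(1)])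
     (use assms in \<open>auto intro!: mult_left_mono power_mono\<close>)

lemma convergent_mpowser_common_radius:
  assumes "convergent_mpowser a" "convergent_mpowser b"
  obtains s::real where "s > 0" "(\<lambda>\<nu>. norm (a \<nu>) * s ^ mdeg \<nu>) summable_on UNIV"
    "(\<lambda>\<nu>. norm (b \<nu>) * s ^ mdeg \<nu>) summable_on UNIV"
proof -
  obtain s t where "s > 0" "t > 0" "(\<lambda>\<nu>. norm (a \<nu>) * s ^ mdeg \<nu>) summable_on UNIV"
    "(\<lambda>\<nu>. norm (b \<nu>) * t ^ mdeg \<nu>) summable_on UNIV"
    using assms unfolding convergent_mpowser_def by blast
  thus thesis using convergent_mpowser_mono[of a s "min s t"] convergent_mpowser_mono[of b t "min s t"] that[of "min s t"] by auto
qed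

lemma convergent_mpowser_add: assumes "convergent_mpowser a" "convergent_mpowser b"
  shows "convergent_mpowser (\<lambda>\<nu>. a \<nu> + b \<nu>)"
proof -
  obtain s::real where s: "s > 0" "(\<lambda>\<nu>. norm (a \<nu>) * s ^ mdeg \<nu>) summable_on UNIV"
    "(\<lambda>\<nu>. norm (b \<nu>) * s ^ mdeg \<nu>) summable_on UNIV" by (rule convergent_mpowser_common_radius[OF assms])
  have "(\<lambda>\<nu>. norm (a \<nu> + b \<nu>) * s ^ mdeg \<nu>) summable_on UNIV"
    by (rule summable_on_comparison_test[OF summable_on_add[OF s(2,3)]])
       (use s in \<open>auto simp flip: distrib_right intro!: mult_right_mono norm_triangle_ineq\<close>)
  thus ?thesis using s unfolding convergent_mpowser_def by blast
qed

lemma convergent_mpowser_mult: assumes "convergent_mpowser a" "convergent_mpowser b"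
  shows "convergent_mpowser (mpowser_mult a b)"
proof -
  obtain s::real where s: "s > 0" "(\<lambda>\<nu>. norm (a \<nu>) * s ^ mdeg \<nu>) summable_on UNIV"
    "(\<lambda>\<nu>. norm (b \<nu>) * s ^ mdeg \<nu>) summable_on UNIV" by (rule convergent_mpowser_common_radius[OF assms])
  define A B where "A \<nu> = norm (a \<nu>) * s ^ mdeg \<nu>" and "B \<nu> = norm (b \<nu>) * s ^ mdeg \<nu>" for \<nu>
  have sum: "A summable_on UNIV" "B summable_on UNIV" using s unfolding A_def[abs_def] B_def[abs_def] by auto
  have nn: "A \<nu> \<ge> 0" "B \<nu> \<ge> 0" for \<nu> using s by (auto simp: A_def B_def)
  let ?g = "\<lambda>p. A (fst p) * B (snd p)"
  have "?g summable_on (Sigma UNIV (\<lambda>_. UNIV))"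
    by (rule summable_on_SigmaI[where g = "\<lambda>\<mu>. A \<mu> * infsum B UNIV"])
       (use sum nn in \<open>auto intro!: has_sum_cmult_right has_sum_infsum summable_on_cmult_left\<close>)
  also have "Sigma UNIV (\<lambda>_. UNIV) = (\<Union>\<nu>. exponent_pairs \<nu>)" by auto
  finally have "(\<lambda>\<nu>. infsum ?g (exponent_pairs \<nu>)) summable_on UNIV"
    by (rule summable_on_UnionD) (auto simp: finite_exponent_pairs disjoint_family_on_def intro!: summable_on_finite)
  hence "(\<lambda>\<nu>. \<Sum>p\<in>exponent_pairs \<nu>. ?g p) summable_on UNIV" by (simp add: finite_exponent_pairs)
  hence "(\<lambda>\<nu>. norm (mpowser_mult a b \<nu>) * s ^ mdeg \<nu>) summable_on UNIV"
  proof (rule summable_on_comparison_test)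
    fix \<nu> :: "nat ^ 'a"
    have "norm (mpowser_mult a b \<nu>) * s ^ mdeg \<nu> \<le> (\<Sum>p\<in>exponent_pairs \<nu>. norm (a (fst p) * b (snd p))) * s ^ mdeg \<nu>"
      unfolding mpowser_mult_def case_prod_unfold using s by (intro mult_right_mono norm_sum) auto
    also have "\<dots> = (\<Sum>p\<in>exponent_pairs \<nu>. ?g p)"
      by (auto simp: sum_distrib_right A_def B_def norm_mult mdeg_add power_add intro!: sum.cong)
    finally show "norm (mpowser_mult a b \<nu>) * s ^ mdeg \<nu> \<le> (\<Sum>p\<in>exponent_pairs \<nu>. ?g p)" .
  qed (use s in auto)
  thus ?thesis using s unfolding convergent_mpowser_def by blast
qed

lemma convergent_mpowser_finite_support: assumes "finite {\<nu>. a \<nu> \<noteq> 0}" shows "convergent_mpowser a"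
proof -
  have "(\<lambda>\<nu>. norm (a \<nu>) * 1 ^ mdeg \<nu>) summable_on {\<nu>. a \<nu> \<noteq> 0}" using assms by simp
  also have "?this \<longleftrightarrow> (\<lambda>\<nu>. norm (a \<nu>) * 1 ^ mdeg \<nu>) summable_on UNIV"
    by (rule summable_on_cong_neutral) auto
  finally show ?thesis unfolding convergent_mpowser_def by (intro exI[of _ 1]) auto
qed

lemma cring_conv_mpowser_ring: "cring (\<C>{x} :: (('n::finite) mpowser) ring)"
proof (rule cringI)
  show "abelian_group (\<C>{x} :: (('n::finite) mpowser) ring)"
    apply (rule abelian_groupI)
         apply (auto simp: conv_mpowser_ring_def convergent_mpowser_add convergent_mpowser_finite_support algebra_simps fun_eq_iff)
    subgoal for x by (rule exI[of _ "\<lambda>\<nu>. - x \<nu>"]) (auto simp: convergent_mpowser_def)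
    done
  show "Group.comm_monoid (\<C>{x} :: (('n::finite) mpowser) ring)"
    apply (rule comm_monoidI)
        apply (auto simp: conv_mpowser_ring_def convergent_mpowser_mult convergent_mpowser_finite_support xmonom_def mpowser_mult_assoc)
    using mpowser_mult_xmonom_0 apply (auto simp: xmonom_def mpowser_mult_commute)[1]
    apply (rule mpowser_mult_commute)
    done
qed (auto simp: conv_mpowser_ring_def mpowser_mult_def fun_eq_iff algebra_simps sum.distrib case_prod_unfold)

definition mpowser_eval :: "('n::finite) mpowser \<Rightarrow> complex ^ 'n \<Rightarrow> complex"
  where "mpowser_eval a x = (\<Sum>\<^sub>\<infinity>\<nu>. a \<nu> * (\<Prod>i\<in>UNIV. x $ i ^ (\<nu> $ i)))"

definition singular_point :: "('n::finite) mpowser \<Rightarrow> complex ^ 'n \<Rightarrow> bool"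
  where "singular_point f x \<longleftrightarrow>
    mpowser_eval f x = 0 \<and> (\<forall>i. mpowser_eval (partial_deriv i f) x = 0)"

definition isolated_singularity_at_origin :: "('n::finite) mpowser \<Rightarrow> bool"
  where "isolated_singularity_at_origin f \<longleftrightarrow>
    singular_point f 0 \<and> (\<forall>\<^sub>F x in at 0. \<not> singular_point f x)"

definition jacobian_ideal :: "('n::finite) mpowser \<Rightarrow> 'n mpowser set"
  where "jacobian_ideal f = Idl\<^bsub>\<C>{x}\<^esub> (range (\<lambda>i. partial_deriv i f))"

definition V :: "('n \<Rightarrow> rat) \<Rightarrow> rat \<Rightarrow> ('n::finite) mpowser set"
  where "V w \<gamma> = Idl\<^bsub>\<C>{x}\<^esub> (xmonom ` {\<nu>. shifted_wdeg w \<nu> \<ge> \<gamma>})"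

abbreviation jacobian_ring :: "('n::finite) mpowser \<Rightarrow> ('n mpowser set) ring"
  where "jacobian_ring f \<equiv> \<C>{x} Quot jacobian_ideal f"

definition jacobian_class :: "('n::finite) mpowser \<Rightarrow> 'n mpowser \<Rightarrow> 'n mpowser set"
  where "jacobian_class f g = jacobian_ideal f +>\<^bsub>\<C>{x}\<^esub> g"

definition VQ :: "('n \<Rightarrow> rat) \<Rightarrow> ('n::finite) mpowser \<Rightarrow> rat \<Rightarrow> 'n mpowser set set"
  where "VQ w f \<gamma> = jacobian_class f ` V w \<gamma>"

definition VQ_gt :: "('n \<Rightarrow> rat) \<Rightarrow> ('n::finite) mpowser \<Rightarrow> rat \<Rightarrow> 'n mpowser set set"
  where "VQ_gt w f \<gamma> = (\<Union>\<beta>\<in>{\<gamma><..}. VQ w f \<beta>)"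

text \<open>
  \<open>VQ_group w f \<gamma>\<close> is the additive group $V^\gamma$ of the Jacobian ring, and \<open>Gr_V w f \<gamma>\<close> its quotient
  group by $V^{>\gamma}$. \<open>Gr_V_image w f \<gamma> g\<close> is the image of $g$ in it; it is an element of
  \<open>carrier (Gr_V w f \<gamma>)\<close> when the class of $g$ lies in $V^\gamma$.
\<close>

definition VQ_group :: "('n \<Rightarrow> rat) \<Rightarrow> ('n::finite) mpowser \<Rightarrow> rat \<Rightarrow> 'n mpowser set monoid"
  where "VQ_group w f \<gamma> =
    \<lparr>carrier = VQ w f \<gamma>, monoid.mult = add (jacobian_ring f), one = zero (jacobian_ring f)\<rparr>"

definition Gr_V :: "('n \<Rightarrow> rat) \<Rightarrow> ('n::finite) mpowser \<Rightarrow> rat \<Rightarrow> 'n mpowser set set monoid"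
  where "Gr_V w f \<gamma> = VQ_group w f \<gamma> Mod VQ_gt w f \<gamma>"

definition Gr_V_image ::
    "('n \<Rightarrow> rat) \<Rightarrow> ('n::finite) mpowser \<Rightarrow> rat \<Rightarrow> 'n mpowser \<Rightarrow> 'n mpowser set set"
  where "Gr_V_image w f \<gamma> g = VQ_gt w f \<gamma> #>\<^bsub>VQ_group w f \<gamma>\<^esub> jacobian_class f g"

end

theory Submission
  imports Defs "HOL-Complex_Analysis.Cauchy_Integral_Formula"
begin

text \<open>
  The first part is a computation of degrees: \<open>n + (2 * d - n + 1) > 2 * d\<close>.

  In the second part the level required of \<open>h\<close> is \<open>n / d\<close>, so that \<open>h = 1\<close> can be taken, and the
  monomial \<open>g = f\<^sub>>\<^sub>1\<close> of degree \<open>2 * d - n\<close> has level exactly \<open>2\<close>. Its image is nonzero if \<open>g\<close> is not the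
  sum of an element of the Jacobian ideal of \<open>f = f\<^sub>1 + g\<close> and of a power series of order greater than
  \<open>2 * d - n\<close>. Two facts give this.

  First, some monomial of degree \<open>2 * d - n\<close> is not a combination of the \<open>\<partial>\<^sub>i f\<^sub>1\<close>. Such a combination has
  coefficients of degree \<open>d - n + 1\<close>, and the products of a monomial of degree \<open>d - n + 1\<close> with some
  \<open>\<partial>\<^sub>i f\<^sub>1\<close> are fewer than the monomials of degree \<open>2 * d - n\<close> (\<open>card_monomials_less\<close>, \<open>functional_vanishing_on_multiples\<close>).

  Second, adding \<open>g\<close> to \<open>f\<^sub>1\<close> does not bring new leading forms into degree \<open>2 * d - n\<close>. If
  \<open>\<Sum>i. b\<^sub>i * \<partial>\<^sub>i f\<close> agrees with \<open>g\<close> up to degree \<open>2 * d - n\<close>, then the constant parts of the \<open>b\<^sub>i\<close>, and once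
  these are known to vanish the linear parts, form a vector field that annihilates \<open>f\<^sub>1\<close>. Such vector fields vanish (\<open>linear_annihilator_eq_0\<close>,
  \<open>constant_annihilator_eq_0\<close>): the gradient of \<open>f\<^sub>1\<close> has no zero besides the origin, which forces the
  one-parameter group generated by a linear vector field that annihilates \<open>f\<^sub>1\<close> to be bounded in complex
  time, hence constant by Liouville's theorem. So all \<open>b\<^sub>i\<close> have order at least \<open>2\<close>, the products
  \<open>b\<^sub>i * \<partial>\<^sub>i g\<close> have order greater than \<open>2 * d - n\<close>, and \<open>g\<close> would be a combination of the \<open>\<partial>\<^sub>i f\<^sub>1\<close>
  (\<open>jacobian_combination_not_leading\<close>).
\<close>

section \<open>Monomials of a given degree and products of homogeneous parts\<close>

abbreviation monomials :: "nat \<Rightarrow> (nat ^ 'n::finite) set"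
  where "monomials k \<equiv> {\<nu>. mdeg \<nu> = k}"

lemma component_le_mdeg: "\<nu> $ i \<le> mdeg \<nu>"
  unfolding mdeg_def by (rule member_le_sum) auto

lemma finite_monomials: "finite (monomials k :: (nat ^ 'n::finite) set)"
proof (rule finite_subset[OF _ finite_exponents_le[of "\<chi> i. k"]])
  show "monomials k \<subseteq> {\<mu>::nat ^ 'n. \<forall>i. \<mu> $ i \<le> (\<chi> i. k) $ i}"
    using component_le_mdeg by auto
qed

lemma mdeg_axis [simp]: "mdeg (axis i k :: nat ^ 'n::finite) = k"
  by (simp add: mdeg_def axis_def)

lemma mdeg_zero [simp]: "mdeg (0 :: nat ^ 'n::finite) = 0"
  by (simp add: mdeg_def)

lemma mdeg_eq_0_iff: "mdeg \<nu> = 0 \<longleftrightarrow> \<nu> = (0 :: nat ^ 'n::finite)"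
  by (auto simp: mdeg_def vec_eq_iff)

lemma monomials_0: "monomials 0 = {0 :: nat ^ 'n::finite}"
  by (auto simp: mdeg_eq_0_iff)

lemma exponent_minus_axis:
  fixes \<nu> :: "nat ^ 'n::finite"
  assumes "\<nu> $ i \<ge> k"
  obtains \<kappa> where "\<nu> = \<kappa> + axis i k"
proof
  show "\<nu> = (\<chi> j. \<nu> $ j - axis i k $ j) + axis i k"
    using assms by (auto simp: vec_eq_iff axis_def)
qed

lemma monomials_1: "monomials 1 = range (\<lambda>j. axis j 1 :: nat ^ 'n::finite)"
proof (intro equalityI subsetI)
  fix \<nu> :: "nat ^ 'n" assume \<nu>: "\<nu> \<in> monomials 1"
  then obtain j where "\<nu> $ j \<ge> 1"
    by (metis (mono_tags) One_nat_def Suc_leI mdeg_eq_0_iff mem_Collect_eq neq0_conv vec_eq_iff zero_index zero_neq_one)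
  then obtain \<kappa> where \<kappa>: "\<nu> = \<kappa> + axis j 1" by (rule exponent_minus_axis)
  with \<nu> have "\<kappa> = 0" by (simp add: mdeg_add mdeg_eq_0_iff)
  with \<kappa> show "\<nu> \<in> range (\<lambda>j. axis j 1)" by simp
qed auto

lemma mpowser_mult_below_order:
  fixes a b :: "('n::finite) mpowser"
  assumes a: "\<And>\<mu>. mdeg \<mu> < p \<Longrightarrow> a \<mu> = 0" and b: "\<And>\<mu>. mdeg \<mu> < q \<Longrightarrow> b \<mu> = 0"
    and \<nu>: "mdeg \<nu> < p + q"
  shows "mpowser_mult a b \<nu> = 0"
  unfolding mpowser_mult_def
proof (rule sum.neutral, clarify)
  fix \<mu> \<kappa> :: "nat ^ 'n" assume "\<nu> = \<mu> + \<kappa>"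
  with \<nu> have "mdeg \<mu> < p \<or> mdeg \<kappa> < q" by (auto simp: mdeg_add)
  with a b show "a \<mu> * b \<kappa> = 0" by auto
qed

text \<open>
  When \<open>b\<close> is homogeneous, the degree \<open>k + e\<close> part of \<open>a * b\<close> sees only the degree \<open>k\<close> part of \<open>a\<close>.
  The weight \<open>\<phi>\<close> stands for a linear functional on forms. It is taken below to be evaluation at a
  point, which turns relations between power series into relations between functions, and a
  functional that annihilates part of the Jacobian ideal.
\<close>

lemma pairing_mpowser_mult:
  fixes a b :: "('n::finite) mpowser"
  assumes b: "\<And>\<kappa>. mdeg \<kappa> \<noteq> e \<Longrightarrow> b \<kappa> = 0"
  shows "(\<Sum>\<nu>\<in>monomials (k + e). \<phi> \<nu> * mpowser_mult a b \<nu>) =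
         (\<Sum>\<mu>\<in>monomials k. \<Sum>\<kappa>\<in>monomials e. \<phi> (\<mu> + \<kappa>) * (a \<mu> * b \<kappa>))"
proof -
  let ?F = "\<lambda>(\<mu>, \<kappa>). \<phi> (\<mu> + \<kappa>) * (a \<mu> * b \<kappa>)"
  have "(\<Sum>\<nu>\<in>monomials (k + e). \<phi> \<nu> * mpowser_mult a b \<nu>) =
        (\<Sum>\<nu>\<in>monomials (k + e). \<Sum>p\<in>exponent_pairs \<nu>. ?F p)"
    unfolding mpowser_mult_def sum_distrib_left by (intro sum.cong) auto
  also have "\<dots> = (\<Sum>p\<in>(\<Union>\<nu>\<in>monomials (k + e). exponent_pairs \<nu>). ?F p)"
    by (rule sum.UNION_disjoint[symmetric]) (auto simp: finite_monomials finite_exponent_pairs)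
  also have "\<dots> = (\<Sum>p\<in>monomials k \<times> monomials e. ?F p)"
  proof (rule sum.mono_neutral_right)
    show "finite (\<Union>\<nu>\<in>monomials (k + e). exponent_pairs (\<nu> :: nat ^ 'n))"
      by (intro finite_UN_I finite_monomials finite_exponent_pairs)
    show "\<forall>p\<in>(\<Union>\<nu>\<in>monomials (k + e). exponent_pairs \<nu>) - monomials k \<times> monomials e. ?F p = 0"
    proof (rule ballI)
      fix p assume p: "p \<in> (\<Union>\<nu>\<in>monomials (k + e). exponent_pairs (\<nu> :: nat ^ 'n)) - monomials k \<times> monomials e"
      have "mdeg (snd p) \<noteq> e" using p by (cases p) (auto simp: mdeg_add)
      thus "?F p = 0" by (simp add: case_prod_unfold b)
    qed
  qed (auto simp: mdeg_add)
  finally show ?thesis by (simp add: sum.cartesian_product)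
qed

section \<open>A form that is not a combination of given partial derivatives\<close>

text \<open>
  Gaussian elimination: one equation is solved for a pivot unknown and substituted in the others.
\<close>

lemma underdetermined_system_nontrivial:
  fixes c :: "'e \<Rightarrow> 'v \<Rightarrow> complex"
  assumes "finite E" "finite M" "card E < card M"
  shows "\<exists>\<phi>. (\<exists>\<nu>\<in>M. \<phi> \<nu> \<noteq> 0) \<and> (\<forall>e\<in>E. (\<Sum>\<nu>\<in>M. c e \<nu> * \<phi> \<nu>) = 0)"
  using assms
proof (induction E arbitrary: M c rule: finite_induct)
  case empty
  hence "M \<noteq> {}" by auto
  thus ?case by (intro exI[of _ "\<lambda>_. 1"]) auto
next
  case (insert e E)
  show ?case
  proof (cases "\<forall>\<nu>\<in>M. c e \<nu> = 0")
    case True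
    have "card E < card M" using insert by simp
    from insert.IH[OF insert.prems(1) this] True show ?thesis by fastforce
  next
    case False
    then obtain \<pi> where \<pi>: "\<pi> \<in> M" "c e \<pi> \<noteq> 0" by blast
    define M' where "M' = M - {\<pi>}"
    have M': "finite M'" "card E < card M'" "\<pi> \<notin> M'" "M = insert \<pi> M'"
      using insert.prems insert.hyps \<pi> by (auto simp: M'_def)
    obtain \<phi> where \<phi>: "\<exists>\<nu>\<in>M'. \<phi> \<nu> \<noteq> 0"
      "\<And>e'. e' \<in> E \<Longrightarrow> (\<Sum>\<nu>\<in>M'. (c e' \<nu> - c e' \<pi> * c e \<nu> / c e \<pi>) * \<phi> \<nu>) = 0"
      using insert.IH[OF M'(1,2), of "\<lambda>e' \<nu>. c e' \<nu> - c e' \<pi> * c e \<nu> / c e \<pi>"] by blast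
    define s where "s = (\<Sum>\<nu>\<in>M'. c e \<nu> * \<phi> \<nu>)"
    define \<psi> where "\<psi> = \<phi>(\<pi> := - s / c e \<pi>)"
    have \<psi>: "(\<Sum>\<nu>\<in>M. c e' \<nu> * \<psi> \<nu>) = (\<Sum>\<nu>\<in>M'. c e' \<nu> * \<phi> \<nu>) - c e' \<pi> * s / c e \<pi>" for e'
    proof -
      have "(\<Sum>\<nu>\<in>M'. c e' \<nu> * \<psi> \<nu>) = (\<Sum>\<nu>\<in>M'. c e' \<nu> * \<phi> \<nu>)"
        using M'(3) by (intro sum.cong) (auto simp: \<psi>_def)
      thus ?thesis using M' by (simp add: \<psi>_def)
    qed
    have "(\<Sum>\<nu>\<in>M. c e' \<nu> * \<psi> \<nu>) = 0" if "e' \<in> insert e E" for e'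
    proof (cases "e' = e")
      case True
      thus ?thesis using \<psi>[of e] \<pi> by (simp add: s_def)
    next
      case False
      hence "0 = (\<Sum>\<nu>\<in>M'. (c e' \<nu> - c e' \<pi> * c e \<nu> / c e \<pi>) * \<phi> \<nu>)"
        using \<phi>(2) that by simp
      also have "\<dots> = (\<Sum>\<nu>\<in>M'. c e' \<nu> * \<phi> \<nu>) - c e' \<pi> / c e \<pi> * s"
        by (simp add: s_def sum_distrib_left sum_subtractf algebra_simps)
      finally show ?thesis by (simp add: \<psi>)
    qed
    moreover have "\<exists>\<nu>\<in>M. \<psi> \<nu> \<noteq> 0" using \<phi>(1) M'(3,4) by (auto simp: \<psi>_def)
    ultimately show ?thesis by blast
  qed
qed

text \<open>
  This is the dimension count for the Fermat polynomial, whose partial derivatives are the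
  \<open>x\<^sub>i ^ (d - 1)\<close> up to scalars. The map \<open>(i, \<mu>) \<mapsto> \<mu> + (d - 1) e\<^sub>i\<close> is injective, because degree
  \<open>2 * d - n\<close> leaves no room for two exponents \<open>\<ge> d - 1\<close>, and it misses the monomials all of whose
  exponents are at most \<open>d - 2\<close>. Three variables suffice to write down such a monomial.
\<close>

lemma card_monomials_less:
  assumes n: "n = CARD('n::finite)" "n \<ge> 3" "n < d"
  shows "card (UNIV \<times> monomials (d - n + 1) :: ('n \<times> (nat ^ 'n)) set) <
         card (monomials (2 * d - n) :: (nat ^ 'n) set)"
proof -
  let ?F = "\<lambda>(i, \<mu>). \<mu> + axis i (d - 1) :: nat ^ 'n"
  let ?A = "UNIV \<times> monomials (d - n + 1) :: ('n \<times> (nat ^ 'n)) set"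
  have inj: "inj_on ?F ?A"
  proof (rule inj_onI, clarify)
    fix i j and \<mu> \<kappa> :: "nat ^ 'n"
    assume eq: "\<mu> + axis i (d - 1) = \<kappa> + axis j (d - 1)" and \<mu>: "mdeg \<mu> = d - n + 1"
    have "i = j"
    proof (rule ccontr)
      assume "i \<noteq> j"
      hence "\<mu> $ j \<ge> d - 1"
        using arg_cong[OF eq, of "\<lambda>\<nu>. \<nu> $ j"] by (simp add: axis_def)
      with component_le_mdeg[of \<mu> j] \<mu> n show False by simp
    qed
    with eq show "i = j \<and> \<mu> = \<kappa>" by simp
  qed
  obtain T :: "'n set" where "card T = 3"
    using n obtain_subset_with_card_n[of 3 "UNIV :: 'n set"] by auto
  then obtain i j k :: 'n where ij: "i \<noteq> j" and k: "k \<noteq> i" "k \<noteq> j"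
    by (auto simp: card_3_iff)
  obtain \<nu> :: "nat ^ 'n" where \<nu>: "mdeg \<nu> = 2 * d - n" "\<And>l. \<nu> $ l \<le> d - 2"
  proof
    \<comment> \<open>The exponents add up to \<open>2 * d - n\<close>, and \<open>n \<ge> 3\<close> gives \<open>d - n + 1 \<le> d - 2\<close>.\<close>
    let ?\<nu> = "axis i (d - 2) + axis j (d - n + 1) + axis k 1 :: nat ^ 'n"
    show "mdeg ?\<nu> = 2 * d - n" using n by (simp add: mdeg_add)
    show "?\<nu> $ l \<le> d - 2" for l using n ij k by (auto simp: axis_def)
  qed
  have "\<nu> \<notin> ?F ` ?A"
  proof clarify
    fix l and \<mu> :: "nat ^ 'n" assume "\<nu> = \<mu> + axis l (d - 1)"
    hence "\<nu> $ l \<ge> d - 1" by simp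
    with \<nu>(2)[of l] n show False by simp
  qed
  hence "?F ` ?A \<subset> monomials (2 * d - n)" using \<nu>(1) n by (auto simp: mdeg_add)
  hence "card (?F ` ?A) < card (monomials (2 * d - n) :: (nat ^ 'n) set)"
    by (intro psubset_card_mono finite_monomials)
  thus ?thesis by (simp only: card_image[OF inj])
qed

text \<open>
  The combinations of \<open>n\<close> forms of degree \<open>d - 1\<close>, with coefficients of degree \<open>d - n + 1\<close>, do not
  exhaust the forms of degree \<open>2 * d - n\<close>: by the count above there are more monomials of that
  degree than spanning products, so that some linear functional \<open>\<phi>\<close> annihilates all products. A
  monomial \<open>\<nu>\<^sub>0\<close> on which \<open>\<phi>\<close> does not vanish is then not such a combination.
\<close>

lemma functional_vanishing_on_multiples:
  fixes D :: "'n \<Rightarrow> ('n::finite) mpowser"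
  assumes n: "n = CARD('n)" "n \<ge> 3" "n < d"
  obtains \<phi> :: "nat ^ 'n \<Rightarrow> complex" and \<nu>\<^sub>0 where "mdeg \<nu>\<^sub>0 = 2 * d - n" "\<phi> \<nu>\<^sub>0 \<noteq> 0"
    "\<And>i \<mu>. mdeg \<mu> = d - n + 1 \<Longrightarrow> (\<Sum>\<kappa>\<in>monomials (d - 1). \<phi> (\<mu> + \<kappa>) * D i \<kappa>) = 0"
proof -
  \<comment> \<open>Only the parts of degree \<open>d - 1\<close> of the \<open>D i\<close> matter; truncation makes the product formula applicable.\<close>
  define b where "b i \<kappa> = (if mdeg \<kappa> = d - 1 then D i \<kappa> else 0)" for i \<kappa>
  obtain \<phi> where \<phi>: "\<exists>\<nu>\<in>monomials (2 * d - n) :: (nat ^ 'n) set. \<phi> \<nu> \<noteq> 0"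
    and eqs: "\<forall>(i, \<mu>) \<in> UNIV \<times> monomials (d - n + 1) :: ('n \<times> (nat ^ 'n)) set.
           (\<Sum>\<nu>\<in>monomials (2 * d - n). mpowser_mult (xmonom \<mu>) (b i) \<nu> * \<phi> \<nu>) = 0"
    using underdetermined_system_nontrivial[OF _ finite_monomials card_monomials_less[OF n],
        of "\<lambda>(i, \<mu>). mpowser_mult (xmonom \<mu>) (b i)"]
    by (auto simp: finite_monomials case_prod_unfold)
  have deg: "2 * d - n = (d - n + 1) + (d - 1)" using n by simp
  have "(\<Sum>\<kappa>\<in>monomials (d - 1). \<phi> (\<mu> + \<kappa>) * D i \<kappa>) = 0" if "mdeg \<mu> = d - n + 1" for i \<mu>
  proof -
    have "0 = (\<Sum>\<nu>\<in>monomials (2 * d - n). \<phi> \<nu> * mpowser_mult (xmonom \<mu>) (b i) \<nu>)"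
      using eqs that by (auto simp: mult.commute)
    also have "\<dots> = (\<Sum>\<mu>'\<in>monomials (d - n + 1). \<Sum>\<kappa>\<in>monomials (d - 1). \<phi> (\<mu>' + \<kappa>) * (xmonom \<mu> \<mu>' * b i \<kappa>))"
      unfolding deg by (rule pairing_mpowser_mult) (simp add: b_def)
    also have "\<dots> = (\<Sum>\<mu>'\<in>{\<mu>}. \<Sum>\<kappa>\<in>monomials (d - 1). \<phi> (\<mu>' + \<kappa>) * (xmonom \<mu> \<mu>' * b i \<kappa>))"
      by (rule sum.mono_neutral_right) (use that in \<open>auto simp: finite_monomials xmonom_def\<close>)
    also have "\<dots> = (\<Sum>\<kappa>\<in>monomials (d - 1). \<phi> (\<mu> + \<kappa>) * D i \<kappa>)"
      by (simp add: xmonom_def b_def)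
    finally show ?thesis by simp
  qed
  with \<phi> that show thesis by blast
qed

section \<open>Values of homogeneous parts\<close>

definition monomial_value :: "complex ^ 'n::finite \<Rightarrow> nat ^ 'n \<Rightarrow> complex"
  where "monomial_value x \<nu> = (\<Prod>i\<in>UNIV. x $ i ^ (\<nu> $ i))"

definition part_value :: "nat \<Rightarrow> ('n::finite) mpowser \<Rightarrow> complex ^ 'n \<Rightarrow> complex"
  where "part_value k a x = (\<Sum>\<nu>\<in>monomials k. a \<nu> * monomial_value x \<nu>)"

lemma monomial_value_add: "monomial_value x (\<mu> + \<kappa>) = monomial_value x \<mu> * monomial_value x \<kappa>"
  by (simp add: monomial_value_def power_add prod.distrib)

lemma monomial_value_axis [simp]: "monomial_value x (axis i k) = x $ i ^ k"
proof -
  have "monomial_value x (axis i k) = (\<Prod>j\<in>UNIV. if j = i then x $ i ^ k else 1)"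
    unfolding monomial_value_def axis_def by (intro prod.cong) auto
  thus ?thesis by simp
qed

lemma monomial_value_0 [simp]: "monomial_value x 0 = 1"
  by (simp add: monomial_value_def)

lemma monomial_value_scale: "monomial_value (t *s x) \<nu> = t ^ mdeg \<nu> * monomial_value x \<nu>"
  by (simp add: monomial_value_def mdeg_def power_mult_distrib prod.distrib power_sum)

lemma part_value_scale: "part_value k a (t *s x) = t ^ k * part_value k a x"
  by (simp add: part_value_def monomial_value_scale sum_distrib_left algebra_simps)

lemma continuous_on_part_value: "continuous_on S (part_value k a)"
  unfolding part_value_def[abs_def] monomial_value_def
  by (intro continuous_intros)

lemma part_value_degree_0: "part_value 0 a x = a 0"
  by (simp add: part_value_def monomials_0)

lemma part_value_degree_1:
  fixes a :: "('n::finite) mpowser"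
  shows "part_value 1 a x = (\<Sum>j\<in>UNIV. a (axis j 1) * x $ j)"
proof -
  have "inj (\<lambda>j::'n. axis j (1::nat))" by (auto simp: inj_def axis_eq_axis)
  thus ?thesis unfolding part_value_def monomials_1 by (simp add: sum.reindex)
qed

lemma mpowser_eval_homogeneous:
  fixes a :: "('n::finite) mpowser"
  assumes "\<And>\<nu>. mdeg \<nu> \<noteq> k \<Longrightarrow> a \<nu> = 0"
  shows "mpowser_eval a x = part_value k a x"
proof -
  have "mpowser_eval a x = (\<Sum>\<^sub>\<infinity>\<nu>\<in>monomials k. a \<nu> * monomial_value x \<nu>)"
    unfolding mpowser_eval_def monomial_value_def
    by (rule infsum_cong_neutral) (use assms in auto)
  thus ?thesis by (simp add: part_value_def finite_monomials)
qed

lemma part_value_mpowser_mult: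
  fixes a b :: "('n::finite) mpowser"
  assumes "\<And>\<kappa>. mdeg \<kappa> \<noteq> e \<Longrightarrow> b \<kappa> = 0"
  shows "part_value (k + e) (mpowser_mult a b) x = part_value k a x * part_value e b x"
proof -
  have "part_value (k + e) (mpowser_mult a b) x =
        (\<Sum>\<nu>\<in>monomials (k + e). monomial_value x \<nu> * mpowser_mult a b \<nu>)"
    by (simp add: part_value_def mult.commute)
  also have "\<dots> = (\<Sum>\<mu>\<in>monomials k. \<Sum>\<kappa>\<in>monomials e. monomial_value x (\<mu> + \<kappa>) * (a \<mu> * b \<kappa>))"
    by (rule pairing_mpowser_mult) (rule assms)
  also have "\<dots> = part_value k a x * part_value e b x"
    by (simp add: part_value_def monomial_value_add sum_product mult_ac)
  finally show ?thesis .
qed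

lemma monomial_value_has_derivative:
  fixes \<gamma> :: "complex \<Rightarrow> complex ^ 'n::finite"
  assumes \<gamma>: "\<And>i. ((\<lambda>t. \<gamma> t $ i) has_field_derivative \<gamma>' i) (at t)"
  shows "((\<lambda>t. monomial_value (\<gamma> t) \<nu>) has_field_derivative
    (\<Sum>i\<in>UNIV. of_nat (\<nu> $ i) * \<gamma> t $ i ^ (\<nu> $ i - 1) * \<gamma>' i * (\<Prod>j\<in>UNIV - {i}. \<gamma> t $ j ^ (\<nu> $ j)))) (at t)"
  unfolding monomial_value_def
  by (rule DERIV_cong[OF has_field_derivative_prod]) (rule derivative_eq_intros refl \<gamma> | simp add: mult_ac)+

lemma monomial_value_split:
  "(\<Prod>j\<in>UNIV - {i}. x $ j ^ ((\<kappa> + axis i 1) $ j)) * x $ i ^ (\<kappa> $ i) = monomial_value x \<kappa>"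
proof -
  have "(\<Prod>j\<in>UNIV - {i}. x $ j ^ ((\<kappa> + axis i 1) $ j)) = (\<Prod>j\<in>UNIV - {i}. x $ j ^ (\<kappa> $ j))"
    by (intro prod.cong) (auto simp: axis_def)
  thus ?thesis unfolding monomial_value_def by (subst (2) prod.remove[of _ i]) (auto simp: mult.commute)
qed

lemma part_value_chain_rule:
  fixes \<gamma> :: "complex \<Rightarrow> complex ^ 'n::finite"
  assumes \<gamma>: "\<And>i. ((\<lambda>t. \<gamma> t $ i) has_field_derivative \<gamma>' i) (at t)"
  shows "((\<lambda>t. part_value (Suc e) a (\<gamma> t)) has_field_derivative
           (\<Sum>i\<in>UNIV. part_value e (partial_deriv i a) (\<gamma> t) * \<gamma>' i)) (at t)"
proof -
  let ?T = "\<lambda>i \<nu>. of_nat (\<nu> $ i) * \<gamma> t $ i ^ (\<nu> $ i - 1) * \<gamma>' i * (\<Prod>j\<in>UNIV - {i}. \<gamma> t $ j ^ (\<nu> $ j))"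
  have "((\<lambda>t. part_value (Suc e) a (\<gamma> t)) has_field_derivative
          (\<Sum>\<nu>\<in>monomials (Suc e). a \<nu> * (\<Sum>i\<in>UNIV. ?T i \<nu>))) (at t)"
    unfolding part_value_def
    by (intro DERIV_sum DERIV_cmult monomial_value_has_derivative \<gamma>)
  also have "(\<Sum>\<nu>\<in>monomials (Suc e). a \<nu> * (\<Sum>i\<in>UNIV. ?T i \<nu>)) =
             (\<Sum>i\<in>UNIV. \<Sum>\<nu>\<in>monomials (Suc e). a \<nu> * ?T i \<nu>)"
    unfolding sum_distrib_left by (rule sum.swap)
  also have "\<dots> = (\<Sum>i\<in>UNIV. part_value e (partial_deriv i a) (\<gamma> t) * \<gamma>' i)"
  proof (rule sum.cong[OF refl])
    fix i :: 'n
    have img: "(\<lambda>\<kappa>. \<kappa> + axis i 1) ` monomials e = {\<nu> \<in> monomials (Suc e). \<nu> $ i \<ge> 1}"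
    proof (intro equalityI subsetI)
      fix \<nu> :: "nat ^ 'n" assume "\<nu> \<in> {\<nu> \<in> monomials (Suc e). \<nu> $ i \<ge> 1}"
      hence \<nu>: "mdeg \<nu> = Suc e" "\<nu> $ i \<ge> 1" by auto
      from \<nu>(2) obtain \<kappa> where "\<nu> = \<kappa> + axis i 1" by (rule exponent_minus_axis)
      with \<nu> show "\<nu> \<in> (\<lambda>\<kappa>. \<kappa> + axis i 1) ` monomials e" by (auto simp: mdeg_add)
    qed (auto simp: mdeg_add)
    have inj: "inj_on (\<lambda>\<kappa>. \<kappa> + axis i 1) (monomials e :: (nat ^ 'n) set)"
      by (auto simp: inj_on_def)
    have "(\<Sum>\<nu>\<in>monomials (Suc e). a \<nu> * ?T i \<nu>) =
          (\<Sum>\<nu>\<in>{\<nu> \<in> monomials (Suc e). \<nu> $ i \<ge> 1}. a \<nu> * ?T i \<nu>)"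
      by (rule sum.mono_neutral_right) (auto simp: finite_monomials not_le)
    also have "\<dots> = (\<Sum>\<kappa>\<in>monomials e. a (\<kappa> + axis i 1) * ?T i (\<kappa> + axis i 1))"
      unfolding img[symmetric] by (subst sum.reindex[OF inj]) (simp only: o_def)
    also have "\<dots> = (\<Sum>\<kappa>\<in>monomials e. partial_deriv i a \<kappa> * monomial_value (\<gamma> t) \<kappa> * \<gamma>' i)"
    proof (rule sum.cong[OF refl])
      fix \<kappa> :: "nat ^ 'n"
      have "(\<kappa> + axis i 1) $ i = \<kappa> $ i + 1" by (simp add: axis_def)
      thus "a (\<kappa> + axis i 1) * ?T i (\<kappa> + axis i 1) =
            partial_deriv i a \<kappa> * monomial_value (\<gamma> t) \<kappa> * \<gamma>' i"
        unfolding monomial_value_split[where i = i and x = "\<gamma> t" and \<kappa> = \<kappa>, symmetric] partial_deriv_def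
        by (simp only: add_diff_cancel_right') (simp only: mult_ac)
    qed
    finally show "(\<Sum>\<nu>\<in>monomials (Suc e). a \<nu> * ?T i \<nu>) =
        part_value e (partial_deriv i a) (\<gamma> t) * \<gamma>' i"
      by (simp add: part_value_def sum_distrib_right)
  qed
  finally show ?thesis .
qed

lemma partial_deriv_homogeneous:
  assumes "\<And>\<nu>. mdeg \<nu> \<noteq> Suc e \<Longrightarrow> a \<nu> = 0" "mdeg \<nu> \<noteq> e"
  shows "partial_deriv i a \<nu> = 0"
  using assms by (simp add: partial_deriv_def mdeg_add)

lemma DERIV_0_imp_constant:
  fixes f :: "complex \<Rightarrow> complex"
  assumes "\<And>t. (f has_field_derivative 0) (at t)"
  shows "f t = f 0"
proof -
  have "f t = f 0"
    by (rule has_field_derivative_zero_constant[of UNIV f, THEN exE]) (use assms in auto)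
  thus ?thesis .
qed

text \<open>
  A common zero \<open>x \<noteq> 0\<close> of the partial derivatives of a form would make the whole line through \<open>x\<close>
  critical. The form is then constant on this line, hence zero on it, and the line consists of
  singular points that accumulate at the origin.
\<close>

lemma isolated_singularity_nondegenerate:
  fixes a :: "('n::finite) mpowser"
  assumes hom: "\<And>\<nu>. mdeg \<nu> \<noteq> Suc e \<Longrightarrow> a \<nu> = 0"
    and iso: "isolated_singularity_at_origin a"
    and crit: "\<And>i. part_value e (partial_deriv i a) x = 0"
  shows "x = 0"
proof (rule ccontr)
  assume x: "x \<noteq> 0"
  have crit': "part_value e (partial_deriv i a) (t *s x) = 0" for i t
    by (simp add: part_value_scale crit)
  have val: "part_value (Suc e) a (t *s x) = 0" for t
  proof -
    have "((\<lambda>t. part_value (Suc e) a (t *s x)) has_field_derivative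
           (\<Sum>i\<in>UNIV. part_value e (partial_deriv i a) (t *s x) * x $ i)) (at t)" for t
      by (rule part_value_chain_rule) (auto intro!: derivative_eq_intros)
    hence "part_value (Suc e) a (t *s x) = part_value (Suc e) a (0 *s x)"
      by (intro DERIV_0_imp_constant[of "\<lambda>t. part_value (Suc e) a (t *s x)"]) (simp add: crit')
    thus ?thesis by (simp only: part_value_scale) simp
  qed
  have sing: "singular_point a (t *s x)" for t
    unfolding singular_point_def
    using mpowser_eval_homogeneous[of "Suc e" a, OF hom] val crit'
      mpowser_eval_homogeneous[of e "partial_deriv i a" for i, OF partial_deriv_homogeneous[OF hom]]
    by simp
  from iso have "\<forall>\<^sub>F y in at 0. \<not> singular_point a y"
    by (simp add: isolated_singularity_at_origin_def)
  then obtain r where r: "r > 0" "\<And>y. y \<noteq> 0 \<Longrightarrow> norm y < r \<Longrightarrow> \<not> singular_point a y"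
    by (auto simp: eventually_at)
  define t where "t = r / (2 * norm x)"
  have t: "t > 0" using r x by (simp add: t_def)
  have eq: "t *\<^sub>R x = complex_of_real t *s x"
  proof (subst vec_eq_iff, rule allI)
    show "(t *\<^sub>R x) $ i = (complex_of_real t *s x) $ i" for i
      unfolding vector_scaleR_component vector_smult_component by (rule scaleR_conv_of_real)
  qed
  have "norm (t *\<^sub>R x) < r" using r x t by (simp add: t_def)
  with r(2)[of "t *\<^sub>R x"] sing[of "complex_of_real t"] x t show False by (simp add: eq[symmetric])
qed

section \<open>The one-parameter group of a linear vector field\<close>

fun matrix_power :: "complex ^ 'n ^ 'n \<Rightarrow> nat \<Rightarrow> complex ^ 'n ^ ('n::finite)"
  where "matrix_power A 0 = mat 1" | "matrix_power A (Suc m) = A ** matrix_power A m"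

lemma matrix_power_Suc_right: "matrix_power A (Suc m) = matrix_power A m ** A"
  by (induction m) (simp_all add: matrix_mul_assoc)

text \<open>
  The matrix exponential \<open>exp (t A)\<close> is defined entry by entry: each entry is an entire function of the
  complex time \<open>t\<close>, to which Liouville's theorem can be applied.
\<close>

definition exp_entry :: "complex ^ 'n ^ 'n \<Rightarrow> 'n \<Rightarrow> 'n \<Rightarrow> complex \<Rightarrow> complex"
  where "exp_entry A i j t = (suminf (\<lambda>m. matrix_power A m $ i $ j / fact m * t ^ m))"

lemma matrix_power_entry_bound:
  "norm (matrix_power A m $ i $ j) \<le> (\<Sum>k\<in>UNIV. \<Sum>l\<in>UNIV. norm (A $ k $ l)) ^ m"
proof (induction m arbitrary: i)
  case 0
  show ?case by (simp add: mat_def)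
next
  case (Suc m)
  let ?b = "\<Sum>k\<in>UNIV. \<Sum>l\<in>UNIV. norm (A $ k $ l)"
  have "norm (matrix_power A (Suc m) $ i $ j) \<le> (\<Sum>l\<in>UNIV. norm (A $ i $ l * matrix_power A m $ l $ j))"
    by (simp add: matrix_matrix_mult_def norm_sum)
  also have "\<dots> \<le> (\<Sum>l\<in>UNIV. norm (A $ i $ l) * ?b ^ m)"
    by (intro sum_mono) (simp add: norm_mult mult_left_mono Suc)
  also have "\<dots> = (\<Sum>l\<in>UNIV. norm (A $ i $ l)) * ?b ^ m"
    by (simp add: sum_distrib_right)
  also have "\<dots> \<le> ?b * ?b ^ m"
    by (intro mult_right_mono member_le_sum[of i UNIV "\<lambda>k. \<Sum>l\<in>UNIV. norm (A $ k $ l)"] zero_le_power sum_nonneg) auto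
  finally show ?case by simp
qed

lemma summable_exp_entry: "summable (\<lambda>m. matrix_power A m $ i $ j / fact m * t ^ m :: complex)"
proof (rule summable_comparison_test)
  let ?b = "\<Sum>k\<in>UNIV. \<Sum>l\<in>UNIV. norm (A $ k $ l)"
  show "summable (\<lambda>m. inverse (fact m) * (?b * norm t) ^ m)" by (rule summable_exp)
  show "\<exists>N. \<forall>m\<ge>N. norm (matrix_power A m $ i $ j / fact m * t ^ m) \<le> inverse (fact m) * (?b * norm t) ^ m"
  proof (intro exI allI impI)
    fix m
    have "norm (matrix_power A m $ i $ j / fact m * t ^ m) =
          norm (matrix_power A m $ i $ j) * (norm t ^ m / fact m)"
      by (simp add: norm_mult norm_divide norm_power)
    also have "\<dots> \<le> ?b ^ m * (norm t ^ m / fact m)"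
      by (intro mult_right_mono matrix_power_entry_bound) auto
    finally show "norm (matrix_power A m $ i $ j / fact m * t ^ m) \<le> inverse (fact m) * (?b * norm t) ^ m"
      by (simp add: power_mult_distrib field_simps)
  qed
qed

lemma exp_entry_0: "exp_entry A i j 0 = (if i = j then 1 else 0)"
  unfolding exp_entry_def by (subst powser_zero) (simp add: mat_def)

lemma exp_entry_has_derivative_power_series:
  "(exp_entry A i j has_field_derivative (suminf (\<lambda>m. matrix_power A (Suc m) $ i $ j / fact m * t ^ m))) (at t)"
proof -
  have "(exp_entry A i j has_field_derivative (suminf (\<lambda>m. diffs (\<lambda>m. matrix_power A m $ i $ j / fact m) m * t ^ m))) (at t)"
    unfolding exp_entry_def[abs_def]
    by (rule termdiffs_strong_converges_everywhere) (rule summable_exp_entry)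
  moreover have "diffs (\<lambda>m. matrix_power A m $ i $ j / fact m) m = matrix_power A (Suc m) $ i $ j / fact m" for m
    by (simp add: diffs_def field_simps del: matrix_power.simps of_nat_Suc)
  ultimately show ?thesis by simp
qed

lemma exp_entry_deriv_left:
  "(exp_entry A i j has_field_derivative (\<Sum>l\<in>UNIV. A $ i $ l * exp_entry A l j t)) (at t)"
proof -
  have "(suminf (\<lambda>m. matrix_power A (Suc m) $ i $ j / fact m * t ^ m)) =
        (suminf (\<lambda>m. \<Sum>l\<in>UNIV. A $ i $ l * (matrix_power A m $ l $ j / fact m * t ^ m)))"
    by (simp add: matrix_matrix_mult_def sum_divide_distrib sum_distrib_right sum_distrib_left mult_ac)
  also have "\<dots> = (\<Sum>l\<in>UNIV. A $ i $ l * exp_entry A l j t)"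
    unfolding exp_entry_def
    by (subst suminf_sum) (simp_all only: suminf_mult summable_exp_entry summable_mult)
  finally show ?thesis using exp_entry_has_derivative_power_series[of A i j t] by simp
qed

lemma exp_entry_deriv_right:
  "(exp_entry A i j has_field_derivative (\<Sum>l\<in>UNIV. exp_entry A i l t * A $ l $ j)) (at t)"
proof -
  have "(suminf (\<lambda>m. matrix_power A (Suc m) $ i $ j / fact m * t ^ m)) =
        (suminf (\<lambda>m. \<Sum>l\<in>UNIV. A $ l $ j * (matrix_power A m $ i $ l / fact m * t ^ m)))"
    by (simp add: matrix_power_Suc_right matrix_matrix_mult_def sum_divide_distrib sum_distrib_right sum_distrib_left mult_ac
        del: matrix_power.simps)
  also have "\<dots> = (\<Sum>l\<in>UNIV. A $ l $ j * exp_entry A i l t)"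
    unfolding exp_entry_def
    by (subst suminf_sum) (simp_all only: suminf_mult summable_exp_entry summable_mult)
  finally show ?thesis using exp_entry_has_derivative_power_series[of A i j t] by (simp add: mult.commute)
qed

definition exp_flow :: "complex ^ 'n ^ 'n \<Rightarrow> complex \<Rightarrow> complex ^ 'n \<Rightarrow> complex ^ ('n::finite)"
  where "exp_flow A t x = (\<chi> i. \<Sum>j\<in>UNIV. exp_entry A i j t * x $ j)"

lemma exp_flow_0: "exp_flow A 0 x = x"
  by (simp add: exp_flow_def exp_entry_0 vec_eq_iff if_distrib[of "\<lambda>c. c * _"] cong: if_cong)

lemma exp_flow_add_scale: "exp_flow A t (x + s *s y) = exp_flow A t x + s *s exp_flow A t y"
  by (simp add: exp_flow_def vec_eq_iff algebra_simps sum.distrib sum_distrib_left)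

lemma exp_flow_axis: "exp_flow A t (axis k 1) $ i = exp_entry A i k t"
  by (simp add: exp_flow_def axis_def if_distrib[of "\<lambda>c. _ * c"] cong: if_cong)

lemma exp_flow_deriv:
  "((\<lambda>t. exp_flow A t x $ i) has_field_derivative (\<Sum>j\<in>UNIV. A $ i $ j * exp_flow A t x $ j)) (at t)"
proof -
  have "((\<lambda>t. exp_flow A t x $ i) has_field_derivative
          (\<Sum>j\<in>UNIV. (\<Sum>l\<in>UNIV. A $ i $ l * exp_entry A l j t) * x $ j)) (at t)"
    unfolding exp_flow_def by (simp, intro DERIV_sum DERIV_cmult_right exp_entry_deriv_left)
  also have "(\<Sum>j\<in>UNIV. (\<Sum>l\<in>UNIV. A $ i $ l * exp_entry A l j t) * x $ j) =
             (\<Sum>j\<in>UNIV. A $ i $ j * exp_flow A t x $ j)"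
    by (simp add: exp_flow_def sum_distrib_left sum_distrib_right mult_ac) (rule sum.swap)
  finally show ?thesis .
qed

lemma exp_entry_minus_deriv:
  "((\<lambda>t. exp_entry A i j (- t)) has_field_derivative - (\<Sum>l\<in>UNIV. A $ i $ l * exp_entry A l j (- t))) (at t)"
  by (rule DERIV_cong[OF DERIV_chain2[where f = "exp_entry A i j" and g = uminus and x = t, OF exp_entry_deriv_left]])
     (auto intro!: derivative_eq_intros)

lemma exp_flow_inverse: "exp_flow A t (exp_flow A (- t) x) = x"
proof -
  \<comment> \<open>\<open>G\<close> is the matrix product \<open>exp (t A) exp (- t A)\<close>, whose derivative is zero because \<open>A\<close> commutes with \<open>exp (t A)\<close>.\<close>
  define G where "G i k t = (\<Sum>j\<in>UNIV. exp_entry A i j t * exp_entry A j k (- t))" for i k t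
  have "(G i k has_field_derivative 0) (at t)" for i k t
  proof -
    have "(G i k has_field_derivative
            (\<Sum>j\<in>UNIV. exp_entry A i j t * (- (\<Sum>l\<in>UNIV. A $ j $ l * exp_entry A l k (- t))) +
                      (\<Sum>l\<in>UNIV. exp_entry A i l t * A $ l $ j) * exp_entry A j k (- t))) (at t)"
      unfolding G_def[abs_def]
      by (intro DERIV_sum DERIV_mult' exp_entry_minus_deriv exp_entry_deriv_right)
    also have "(\<Sum>j\<in>UNIV. exp_entry A i j t * (- (\<Sum>l\<in>UNIV. A $ j $ l * exp_entry A l k (- t))) +
                      (\<Sum>l\<in>UNIV. exp_entry A i l t * A $ l $ j) * exp_entry A j k (- t)) =
        (\<Sum>l\<in>UNIV. \<Sum>j\<in>UNIV. exp_entry A i j t * A $ j $ l * exp_entry A l k (- t)) -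
        (\<Sum>j\<in>UNIV. \<Sum>l\<in>UNIV. exp_entry A i j t * A $ j $ l * exp_entry A l k (- t))"
      by (simp add: sum.distrib sum_subtractf sum_distrib_left sum_distrib_right sum_negf mult_ac)
    also have "\<dots> = 0" by (subst sum.swap) simp
    finally show ?thesis .
  qed
  hence "G i k t = G i k 0" for i k by (rule DERIV_0_imp_constant)
  hence G: "G i k t = (if i = k then 1 else 0)" for i k
    by (simp add: G_def exp_entry_0 if_distrib[of "\<lambda>c. c * _"] cong: if_cong)
  have "exp_flow A t (exp_flow A (- t) x) $ i = (\<Sum>k\<in>UNIV. G i k t * x $ k)" for i
    by (simp add: exp_flow_def G_def sum_distrib_left sum_distrib_right mult_ac) (rule sum.swap)
  thus ?thesis by (simp add: G vec_eq_iff if_distrib[of "\<lambda>c. c * _"] cong: if_cong)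
qed

section \<open>Linear vector fields annihilating a nondegenerate form\<close>

text \<open>
  A form annihilated by the vector field \<open>x \<mapsto> A x\<close> is invariant under \<open>exp (t A)\<close>. Differentiating this
  invariance in the initial point shows that \<open>exp (t A)\<close> transports the gradient by the inverse
  transpose, which bounds the gradient at \<open>exp (t A) u\<close> by the entries of \<open>exp (- t A)\<close>.
\<close>

lemma gradient_along_flow:
  fixes a :: "('n::finite) mpowser"
  assumes ann: "\<And>x. (\<Sum>i\<in>UNIV. part_value e (partial_deriv i a) x * (\<Sum>j\<in>UNIV. A $ i $ j * x $ j)) = 0"
  shows "(\<Sum>i\<in>UNIV. part_value e (partial_deriv i a) (exp_flow A t u) * z $ i) =
         (\<Sum>i\<in>UNIV. part_value e (partial_deriv i a) u * exp_flow A (- t) z $ i)"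
proof -
  have inv: "part_value (Suc e) a (exp_flow A t x) = part_value (Suc e) a x" for t x
  proof -
    have "((\<lambda>t. part_value (Suc e) a (exp_flow A t x)) has_field_derivative
       (\<Sum>i\<in>UNIV. part_value e (partial_deriv i a) (exp_flow A t x) * (\<Sum>j\<in>UNIV. A $ i $ j * exp_flow A t x $ j))) (at t)" for t
      by (rule part_value_chain_rule) (rule exp_flow_deriv)
    hence "((\<lambda>t. part_value (Suc e) a (exp_flow A t x)) has_field_derivative 0) (at t)" for t
      by (simp only: ann)
    from DERIV_0_imp_constant[OF this, of t] show ?thesis by (simp add: exp_flow_0)
  qed
  \<comment> \<open>The flow carries the line \<open>u + s y\<close> to \<open>exp (t A) u + s z\<close>, and the form takes the same values on both.\<close>
  define y where "y = exp_flow A (- t) z"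
  have line: "((\<lambda>s. part_value (Suc e) a (v + s *s w)) has_field_derivative
        (\<Sum>i\<in>UNIV. part_value e (partial_deriv i a) v * w $ i)) (at 0)" for v w
  proof -
    have "((\<lambda>s. (v + s *s w) $ i) has_field_derivative w $ i) (at 0)" for i
      by (auto intro!: derivative_eq_intros)
    from part_value_chain_rule[OF this, of e a] show ?thesis by simp
  qed
  have "part_value (Suc e) a (exp_flow A t u + s *s z) = part_value (Suc e) a (u + s *s y)" for s
    using inv[of t "u + s *s y"] by (simp add: exp_flow_add_scale y_def exp_flow_inverse)
  hence "((\<lambda>s. part_value (Suc e) a (u + s *s y)) has_field_derivative
        (\<Sum>i\<in>UNIV. part_value e (partial_deriv i a) (exp_flow A t u) * z $ i)) (at 0)"
    using line[of "exp_flow A t u" z] by simp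
  from DERIV_unique[OF this line] show ?thesis by (simp add: y_def)
qed

text \<open>
  The sum on the right is homogeneous of degree \<open>e\<close> under scaling by positive reals, and has a
  positive minimum on the compact unit sphere.
\<close>

lemma gradient_growth:
  fixes D :: "'n::finite \<Rightarrow> 'n mpowser"
  assumes nondeg: "\<And>x. (\<And>i. part_value e (D i) x = 0) \<Longrightarrow> x = 0"
  obtains c where "c > 0" "\<And>x. c * norm x ^ e \<le> (\<Sum>i\<in>UNIV. norm (part_value e (D i) x))"
proof -
  let ?g = "\<lambda>x. \<Sum>i\<in>UNIV. norm (part_value e (D i) x)"
  have "continuous_on (sphere 0 1) ?g"
    by (intro continuous_intros continuous_on_part_value)
  moreover have "compact (sphere (0 :: complex ^ 'n) 1)" by (rule compact_sphere)
  moreover have "axis (undefined :: 'n) 1 \<in> sphere (0 :: complex ^ 'n) 1" by (simp add: norm_axis_1)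
  ultimately obtain x\<^sub>0 where x0: "x\<^sub>0 \<in> sphere 0 1" "\<And>x. x \<in> sphere 0 1 \<Longrightarrow> ?g x\<^sub>0 \<le> ?g x"
    using continuous_attains_inf[of "sphere (0 :: complex ^ 'n) 1" ?g] by blast
  have pos: "?g x\<^sub>0 > 0"
  proof (rule ccontr)
    assume "\<not> ?g x\<^sub>0 > 0"
    hence "?g x\<^sub>0 = 0" by (meson norm_ge_zero not_less order_antisym sum_nonneg)
    hence "part_value e (D i) x\<^sub>0 = 0" for i by (simp add: sum_nonneg_eq_0_iff)
    with nondeg[of x\<^sub>0] x0(1) show False by simp
  qed
  show thesis
  proof (rule that[OF pos])
    fix x :: "complex ^ 'n"
    show "?g x\<^sub>0 * norm x ^ e \<le> ?g x"
    proof (cases "x = 0")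
      case False
      define y where "y = (1 / norm x) *\<^sub>R x"
      have y: "y \<in> sphere 0 1" using False by (simp add: y_def)
      have x: "x = complex_of_real (norm x) *s y"
      proof (subst vec_eq_iff, rule allI)
        fix i show "x $ i = (complex_of_real (norm x) *s y) $ i"
          unfolding y_def vector_smult_component vector_scaleR_component
          using False by (simp add: scaleR_conv_of_real)
      qed
      have "?g x = norm x ^ e * ?g y"
        by (subst x) (simp add: part_value_scale norm_mult norm_power sum_distrib_left)
      also have "\<dots> \<ge> norm x ^ e * ?g x\<^sub>0"
        by (intro mult_left_mono x0(2) y) simp
      finally show ?thesis by (simp add: mult.commute)
    next
      case True
      have "0 \<le> ?g y" for y by (intro sum_nonneg) auto
      moreover have "?g x\<^sub>0 \<le> ?g x" if "e = 0"
        using that by (simp add: part_value_degree_0)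
      ultimately show ?thesis using True by (cases e) auto
    qed
  qed
qed

text \<open>
  The symmetry group of a nondegenerate form of degree \<open>e + 1 \<ge> 3\<close> is discrete. Indeed the gradient
  grows like the power \<open>e\<close> of the norm, while transport along the flow makes it grow at most like the
  inverse flow. Hence the largest entry \<open>X\<close> of \<open>exp (t A)\<close> and \<open>exp (- t A)\<close> satisfies \<open>X ^ e \<le> C * X\<close>,
  and \<open>e \<ge> 2\<close> makes it bounded uniformly in the complex time \<open>t\<close>. Liouville's theorem then makes
  \<open>exp (t A)\<close> constant, and its derivative \<open>A\<close> at \<open>0\<close> vanishes. This takes the place of an
  argument by regular sequences and Koszul syzygies.
\<close>

lemma linear_annihilator_eq_0:
  fixes a :: "('n::finite) mpowser"
  assumes e: "e \<ge> 2"
    and nondeg: "\<And>x. (\<And>i. part_value e (partial_deriv i a) x = 0) \<Longrightarrow> x = 0"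
    and ann: "\<And>x. (\<Sum>i\<in>UNIV. part_value e (partial_deriv i a) x * (\<Sum>j\<in>UNIV. A $ i $ j * x $ j)) = 0"
  shows "A = 0"
proof -
  let ?D = "\<lambda>i. part_value e (partial_deriv i a)"
  obtain c where c: "c > 0" "\<And>x. c * norm x ^ e \<le> (\<Sum>i\<in>UNIV. norm (?D i x))"
    using gradient_growth[of e "\<lambda>i. partial_deriv i a", OF nondeg] by blast
  define C where "C = (\<Sum>i\<in>(UNIV::'n set). \<Sum>k\<in>UNIV. \<Sum>j\<in>UNIV. norm (?D j (axis k 1))) / c"
  have step: "norm (exp_entry A i k t) ^ e \<le> C * X"
    if X: "\<And>i k. norm (exp_entry A i k (- t)) \<le> X" for i k t X
  proof -
    let ?u = "axis k 1 :: complex ^ 'n"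
    have D: "?D l (exp_flow A t ?u) = (\<Sum>j\<in>UNIV. ?D j ?u * exp_entry A j l (- t))" for l
    proof -
      have "?D l (exp_flow A t ?u) = (\<Sum>j\<in>UNIV. ?D j (exp_flow A t ?u) * axis l 1 $ j)"
        by (simp add: axis_def if_distrib[of "\<lambda>c. _ * c"] cong: if_cong)
      thus ?thesis by (simp add: gradient_along_flow[OF ann] exp_flow_axis)
    qed
    have X0: "X \<ge> 0" using X[of i k] norm_ge_zero order_trans by blast
    have "norm (exp_entry A i k t) \<le> norm (exp_flow A t ?u)"
      using Finite_Cartesian_Product.norm_nth_le[of "exp_flow A t ?u" i] by (simp add: exp_flow_axis)
    hence "c * norm (exp_entry A i k t) ^ e \<le> c * norm (exp_flow A t ?u) ^ e"
      using c by (intro mult_left_mono power_mono) auto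
    also have "\<dots> \<le> (\<Sum>l\<in>UNIV. norm (?D l (exp_flow A t ?u)))" by (rule c)
    also have "\<dots> \<le> (\<Sum>l\<in>(UNIV::'n set). \<Sum>j\<in>UNIV. norm (?D j ?u) * X)"
      unfolding D
      by (intro sum_mono order_trans[OF norm_sum]) (simp add: norm_mult mult_left_mono X)
    also have "\<dots> = (\<Sum>l\<in>(UNIV::'n set). \<Sum>j\<in>UNIV. norm (?D j ?u)) * X"
      by (simp add: sum_distrib_right mult.assoc)
    also have "\<dots> \<le> (\<Sum>l\<in>(UNIV::'n set). \<Sum>k\<in>UNIV. \<Sum>j\<in>UNIV. norm (?D j (axis k 1))) * X"
      by (intro mult_right_mono sum_mono X0 member_le_sum[of k UNIV "\<lambda>k. \<Sum>j\<in>UNIV. norm (?D j (axis k 1))"] sum_nonneg) auto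
    also have "\<dots> = c * (C * X)" using c by (simp add: C_def)
    finally show ?thesis using c by simp
  qed
  have bound: "norm (exp_entry A i k t) \<le> max 1 C" for i k t
  proof -
    \<comment> \<open>Both signs of \<open>t\<close> go into one maximum, so that a single inequality suffices.\<close>
    define S where "S = (\<lambda>(i, k, b). norm (exp_entry A i k (if b then t else - t))) ` UNIV"
    define X where "X = Max S"
    have fin: "finite S" by (simp add: S_def)
    have inS: "norm (exp_entry A i k (if b then t else - t)) \<in> S" for i k b
      unfolding S_def by (rule image_eqI[of _ _ "(i, k, b)"]) auto
    have le: "norm (exp_entry A i k t) \<le> X" "norm (exp_entry A i k (- t)) \<le> X" for i k
      using Max_ge[OF fin inS[of i k True]] Max_ge[OF fin inS[of i k False]] by (simp_all add: X_def)
    have "X \<in> S" unfolding X_def by (rule Max_in[OF fin]) (simp add: S_def)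
    then obtain i' k' and b :: bool where "X = norm (exp_entry A i' k' (if b then t else - t))"
      by (auto simp: S_def)
    hence pow: "X ^ e \<le> C * X" using step[of t X i' k'] step[of "- t" X i' k'] le by (cases b) auto
    have "X \<le> max 1 C"
    proof (cases "X \<le> 1")
      case False
      have "X * X \<le> X ^ e"
        using False e power_increasing[of 2 e X] by (simp add: power2_eq_square)
      with pow have "X * X \<le> C * X" by simp
      thus ?thesis using False by simp
    qed auto
    with le(1) show ?thesis by (rule order_trans)
  qed
  have "A $ i $ k = 0" for i k
  proof -
    have "exp_entry A i k holomorphic_on UNIV"
      using exp_entry_deriv_left[of A i k]
      by (subst holomorphic_on_open) auto
    moreover have "bounded (range (exp_entry A i k))" using bound by (auto simp: bounded_iff)
    ultimately obtain b where "exp_entry A i k t = b" for t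
      using Liouville_theorem by (auto simp: constant_on_def)
    hence "(exp_entry A i k has_field_derivative 0) (at 0)"
      by (simp add: fun_eq_iff[of "exp_entry A i k" "\<lambda>_. b", THEN iffD2])
    from DERIV_unique[OF this exp_entry_deriv_left] show ?thesis
      by (simp add: exp_entry_0 if_distrib[of "\<lambda>c. _ * c"] cong: if_cong)
  qed
  thus ?thesis by (simp add: vec_eq_iff)
qed

text \<open>
  Multiplying a constant vector field by one coordinate function makes it linear.
\<close>

lemma constant_annihilator_eq_0:
  fixes a :: "('n::finite) mpowser"
  assumes e: "e \<ge> 2"
    and nondeg: "\<And>x. (\<And>i. part_value e (partial_deriv i a) x = 0) \<Longrightarrow> x = 0"
    and ann: "\<And>x. (\<Sum>i\<in>UNIV. part_value e (partial_deriv i a) x * c i) = 0"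
  shows "c i = 0"
proof -
  define A :: "complex ^ 'n ^ 'n" where "A = (\<chi> i j. if j = undefined then c i else 0)"
  have "(\<Sum>i\<in>UNIV. part_value e (partial_deriv i a) x * (\<Sum>j\<in>UNIV. A $ i $ j * x $ j)) = 0" for x
  proof -
    have "(\<Sum>i\<in>UNIV. part_value e (partial_deriv i a) x * (\<Sum>j\<in>UNIV. A $ i $ j * x $ j)) =
          (\<Sum>i\<in>UNIV. part_value e (partial_deriv i a) x * c i) * x $ undefined"
      by (simp add: A_def if_distrib[of "\<lambda>c. c * _"] sum_distrib_right mult.assoc cong: if_cong)
    thus ?thesis by (simp add: ann)
  qed
  hence "A = 0" by (rule linear_annihilator_eq_0[OF e nondeg, rotated])
  hence "A $ i $ undefined = 0" by simp
  thus ?thesis by (simp add: A_def)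
qed

section \<open>Ideals of convergent power series\<close>

lemma carrier_conv_mpowser_ring [simp]: "a \<in> carrier \<C>{x} \<longleftrightarrow> convergent_mpowser a"
  by (simp add: conv_mpowser_ring_def)

lemma mult_conv_mpowser_ring [simp]: "a \<otimes>\<^bsub>\<C>{x}\<^esub> b = mpowser_mult a b"
  by (simp add: conv_mpowser_ring_def)

lemma add_conv_mpowser_ring [simp]: "a \<oplus>\<^bsub>\<C>{x}\<^esub> b = (\<lambda>\<nu>. a \<nu> + b \<nu>)"
  by (simp add: conv_mpowser_ring_def)

lemma zero_conv_mpowser_ring [simp]: "\<zero>\<^bsub>\<C>{x}\<^esub> = (\<lambda>\<nu>. 0)"
  by (simp add: conv_mpowser_ring_def)

lemma one_conv_mpowser_ring [simp]: "\<one>\<^bsub>\<C>{x}\<^esub> = xmonom 0"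
  by (simp add: conv_mpowser_ring_def)

lemma ring_conv_mpowser_ring: "ring (\<C>{x} :: (('n::finite) mpowser) ring)"
  by (rule cring.axioms(1)[OF cring_conv_mpowser_ring])

lemma idealI_mpowser:
  fixes I :: "('n::finite) mpowser set"
  assumes conv: "\<And>a. a \<in> I \<Longrightarrow> convergent_mpowser a"
    and zero: "(\<lambda>\<nu>. 0) \<in> I"
    and add: "\<And>a b. a \<in> I \<Longrightarrow> b \<in> I \<Longrightarrow> (\<lambda>\<nu>. a \<nu> + b \<nu>) \<in> I"
    and mult: "\<And>a b. convergent_mpowser a \<Longrightarrow> b \<in> I \<Longrightarrow> mpowser_mult a b \<in> I"
  shows "ideal I \<C>{x}"
proof -
  interpret R: cring "\<C>{x} :: ('n mpowser) ring" by (rule cring_conv_mpowser_ring)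
  have neg: "\<ominus>\<^bsub>\<C>{x}\<^esub> a \<in> I" if "a \<in> I" for a
  proof -
    have a: "a \<in> carrier \<C>{x}" using conv[OF that] by simp
    have "\<ominus>\<^bsub>\<C>{x}\<^esub> a = (\<ominus>\<^bsub>\<C>{x}\<^esub> \<one>\<^bsub>\<C>{x}\<^esub>) \<otimes>\<^bsub>\<C>{x}\<^esub> a"
      using R.l_minus[OF R.one_closed a] R.l_one[OF a] by (simp only:)
    moreover have "convergent_mpowser (\<ominus>\<^bsub>\<C>{x}\<^esub> \<one>\<^bsub>\<C>{x}\<^esub> :: 'n mpowser)"
      using R.a_inv_closed[OF R.one_closed] by (simp only: carrier_conv_mpowser_ring)
    ultimately show ?thesis using mult that by (simp only: mult_conv_mpowser_ring)
  qed
  have sub: "I \<subseteq> carrier \<C>{x}" using conv by auto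
  have "subgroup I (add_monoid \<C>{x})"
  proof (rule R.add.subgroupI)
    show "I \<subseteq> carrier \<C>{x}" by (rule sub)
    show "I \<noteq> {}" using zero by auto
    show "\<ominus>\<^bsub>\<C>{x}\<^esub> a \<in> I" if "a \<in> I" for a by (rule neg[OF that])
    show "a \<oplus>\<^bsub>\<C>{x}\<^esub> b \<in> I" if "a \<in> I" "b \<in> I" for a b using add that by simp
  qed
  thus ?thesis
  proof (rule idealI[OF ring_conv_mpowser_ring])
    show "x \<otimes>\<^bsub>\<C>{x}\<^esub> a \<in> I" if "a \<in> I" "x \<in> carrier \<C>{x}" for a x
      using mult that by simp
    show "a \<otimes>\<^bsub>\<C>{x}\<^esub> x \<in> I" if "a \<in> I" "x \<in> carrier \<C>{x}" for a x
      using mult that by (simp add: mpowser_mult_commute[of a])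
  qed
qed

text \<open>
  In an induction on an ideal the multiplier \<open>a\<close> may be any formal power series; this lets facts about
  coefficients be proved without convergence.
\<close>

lemma genideal_mpowser_induct:
  fixes S :: "('n::finite) mpowser set"
  assumes "a \<in> Idl\<^bsub>\<C>{x}\<^esub> S"
    and "\<And>s. s \<in> S \<Longrightarrow> convergent_mpowser s \<and> P s" and "P (\<lambda>\<nu>. 0)"
    and "\<And>a b. P a \<Longrightarrow> P b \<Longrightarrow> P (\<lambda>\<nu>. a \<nu> + b \<nu>)"
    and "\<And>a b. P b \<Longrightarrow> P (mpowser_mult a b)"
  shows "P a"
proof -
  interpret ring "\<C>{x} :: ('n mpowser) ring" by (rule ring_conv_mpowser_ring)
  have "ideal {a. convergent_mpowser a \<and> P a} \<C>{x}"
    by (rule idealI_mpowser)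
       (use assms(3-5) convergent_mpowser_finite_support[of "\<lambda>_. 0"] in
         \<open>auto intro: convergent_mpowser_add convergent_mpowser_mult\<close>)
  from genideal_minimal[OF this, of S] assms(1,2) show ?thesis by auto
qed

lemma convergent_xmonom: "convergent_mpowser (xmonom \<nu>)"
  by (rule convergent_mpowser_finite_support) (simp add: xmonom_def)

lemma V_coeff_eq_0:
  fixes \<nu> :: "nat ^ 'n::finite"
  assumes "a \<in> V w \<gamma>" "\<And>\<mu>. mdeg \<mu> \<le> k \<Longrightarrow> shifted_wdeg w \<mu> < \<gamma>" "mdeg \<nu> \<le> k"
  shows "a \<nu> = 0"
proof -
  have "\<forall>\<nu>. mdeg \<nu> < Suc k \<longrightarrow> a \<nu> = 0"
    using assms(1) unfolding V_def
  proof (rule genideal_mpowser_induct)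
    fix s assume "s \<in> xmonom ` {\<nu>. \<gamma> \<le> shifted_wdeg w \<nu>}"
    then obtain \<mu> where \<mu>: "s = xmonom \<mu>" "\<gamma> \<le> shifted_wdeg w \<mu>" by auto
    hence "\<not> mdeg \<mu> \<le> k" using assms(2)[of \<mu>] by auto
    with \<mu> convergent_xmonom[of \<mu>]
    show "convergent_mpowser s \<and> (\<forall>\<nu>. mdeg \<nu> < Suc k \<longrightarrow> s \<nu> = 0)"
      by (auto simp: xmonom_def)
  next
    fix a b :: "'n mpowser" assume "\<forall>\<nu>. mdeg \<nu> < Suc k \<longrightarrow> b \<nu> = 0"
    thus "\<forall>\<nu>. mdeg \<nu> < Suc k \<longrightarrow> mpowser_mult a b \<nu> = 0"
      by (auto intro: mpowser_mult_below_order[of 0 a "Suc k" b])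
  qed auto
  with assms(3) show ?thesis by simp
qed

lemma V_memI:
  fixes \<nu> :: "nat ^ 'n::finite"
  assumes "shifted_wdeg w \<nu> \<ge> \<gamma>"
  shows "xmonom \<nu> \<in> V w \<gamma>"
proof -
  interpret ring "\<C>{x} :: ('n mpowser) ring" by (rule ring_conv_mpowser_ring)
  have "xmonom ` {\<nu>. \<gamma> \<le> shifted_wdeg w \<nu>} \<subseteq> carrier (\<C>{x} :: ('n mpowser) ring)"
    by (auto simp: convergent_xmonom)
  from genideal_self[OF this] assms show ?thesis by (auto simp: V_def)
qed

lemma jacobian_ideal_combination:
  fixes f :: "('n::finite) mpowser"
  assumes "j \<in> jacobian_ideal f" "\<And>i. convergent_mpowser (partial_deriv i f)"
  obtains a where "j = (\<lambda>\<nu>. \<Sum>i\<in>UNIV. mpowser_mult (a i) (partial_deriv i f) \<nu>)"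
proof -
  have "\<exists>a. j = (\<lambda>\<nu>. \<Sum>i\<in>UNIV. mpowser_mult (a i) (partial_deriv i f) \<nu>)"
    using assms(1) unfolding jacobian_ideal_def
  proof (rule genideal_mpowser_induct)
    fix s assume "s \<in> range (\<lambda>i. partial_deriv i f)"
    then obtain k where s: "s = partial_deriv k f" by auto
    have "s = (\<lambda>\<nu>. \<Sum>i\<in>UNIV. mpowser_mult (if i = k then xmonom 0 else (\<lambda>_. 0)) (partial_deriv i f) \<nu>)"
    proof
      fix \<nu>
      have "mpowser_mult (if i = k then xmonom 0 else (\<lambda>_. 0)) (partial_deriv i f) \<nu> =
            (if i = k then s \<nu> else 0)" for i
        using mpowser_mult_xmonom_0[of s] by (simp add: s) (simp add: mpowser_mult_def)
      thus "s \<nu> = (\<Sum>i\<in>UNIV. mpowser_mult (if i = k then xmonom 0 else (\<lambda>_. 0)) (partial_deriv i f) \<nu>)"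
        by simp
    qed
    with assms(2) s show "convergent_mpowser s \<and>
        (\<exists>a. s = (\<lambda>\<nu>. \<Sum>i\<in>UNIV. mpowser_mult (a i) (partial_deriv i f) \<nu>))"
      by (intro conjI exI[of _ "\<lambda>i. if i = k then xmonom 0 else (\<lambda>_. 0)"]) simp_all
  next
    show "\<exists>a. (\<lambda>\<nu>. 0) = (\<lambda>\<nu>. \<Sum>i\<in>UNIV. mpowser_mult (a i) (partial_deriv i f) \<nu>)"
      by (rule exI[of _ "\<lambda>_ _. 0"]) (simp add: mpowser_mult_def case_prod_unfold)
  next
    fix p q
    assume "\<exists>a. p = (\<lambda>\<nu>. \<Sum>i\<in>UNIV. mpowser_mult (a i) (partial_deriv i f) \<nu>)"
      "\<exists>a. q = (\<lambda>\<nu>. \<Sum>i\<in>UNIV. mpowser_mult (a i) (partial_deriv i f) \<nu>)"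
    then obtain a b where "p = (\<lambda>\<nu>. \<Sum>i\<in>UNIV. mpowser_mult (a i) (partial_deriv i f) \<nu>)"
      "q = (\<lambda>\<nu>. \<Sum>i\<in>UNIV. mpowser_mult (b i) (partial_deriv i f) \<nu>)" by blast
    thus "\<exists>a. (\<lambda>\<nu>. p \<nu> + q \<nu>) = (\<lambda>\<nu>. \<Sum>i\<in>UNIV. mpowser_mult (a i) (partial_deriv i f) \<nu>)"
      by (intro exI[of _ "\<lambda>i \<nu>. a i \<nu> + b i \<nu>"])
         (simp add: mpowser_mult_def case_prod_unfold sum.distrib algebra_simps)
  next
    fix p q
    assume "\<exists>a. q = (\<lambda>\<nu>. \<Sum>i\<in>UNIV. mpowser_mult (a i) (partial_deriv i f) \<nu>)"
    then obtain a where q: "q = (\<lambda>\<nu>. \<Sum>i\<in>UNIV. mpowser_mult (a i) (partial_deriv i f) \<nu>)" by blast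
    have "mpowser_mult p q \<nu> = (\<Sum>i\<in>UNIV. mpowser_mult p (mpowser_mult (a i) (partial_deriv i f)) \<nu>)" for \<nu>
      unfolding q mpowser_mult_def[of p] case_prod_unfold sum_distrib_left by (rule sum.swap)
    thus "\<exists>a. mpowser_mult p q = (\<lambda>\<nu>. \<Sum>i\<in>UNIV. mpowser_mult (a i) (partial_deriv i f) \<nu>)"
      by (intro exI[of _ "\<lambda>i. mpowser_mult p (a i)"]) (simp add: mpowser_mult_assoc fun_eq_iff)
  qed
  with that show thesis by blast
qed

section \<open>The leading part of an element of the Jacobian ideal\<close>

text \<open>
  Let \<open>f = a + x\<^sup>\<nu>\<^sup>0\<close> and suppose that \<open>\<Sum>i. b\<^sub>i * \<partial>\<^sub>i f\<close> agrees with \<open>x\<^sup>\<nu>\<^sup>0\<close> up to degree \<open>2 * d - n\<close>. The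
  derivatives of \<open>x\<^sup>\<nu>\<^sup>0\<close> have degree \<open>2 * d - n - 1 \<ge> d\<close>, so in the degrees \<open>d - 1\<close> and \<open>d\<close> the combination
  yields relations between the \<open>\<partial>\<^sub>i a\<close> with constant and linear coefficients. By the rigidity of \<open>a\<close>
  both are trivial, so every \<open>b\<^sub>i\<close> has order at least \<open>2\<close>. So the derivatives of \<open>x\<^sup>\<nu>\<^sup>0\<close> do not
  contribute in degree \<open>2 * d - n\<close> either, and \<open>x\<^sup>\<nu>\<^sup>0\<close> is a combination of the \<open>\<partial>\<^sub>i a\<close>, which contradicts
  \<open>\<phi>\<close>.
\<close>

lemma jacobian_combination_not_leading:
  fixes a :: "('n::finite) mpowser" and b :: "'n \<Rightarrow> 'n mpowser"
  assumes n: "n = CARD('n)" "n \<ge> 3" "n < d"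
    and hom: "\<And>\<nu>. mdeg \<nu> \<noteq> d \<Longrightarrow> a \<nu> = 0"
    and iso: "isolated_singularity_at_origin a"
    and \<nu>0: "mdeg \<nu>\<^sub>0 = 2 * d - n" "\<phi> \<nu>\<^sub>0 \<noteq> 0"
    and \<phi>: "\<And>i \<mu>. mdeg \<mu> = d - n + 1 \<Longrightarrow>
              (\<Sum>\<kappa>\<in>monomials (d - 1). \<phi> (\<mu> + \<kappa>) * partial_deriv i a \<kappa>) = 0"
    and comb: "\<And>\<nu>. mdeg \<nu> \<le> 2 * d - n \<Longrightarrow>
      (\<Sum>i\<in>UNIV. mpowser_mult (b i) (partial_deriv i (\<lambda>\<nu>. a \<nu> + xmonom \<nu>\<^sub>0 \<nu>)) \<nu>) = xmonom \<nu>\<^sub>0 \<nu>"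
  shows False
proof -
  define e where "e = d - 1"
  have d: "d = Suc e" "e \<ge> 2" using n by (auto simp: e_def)
  have hom': "mdeg \<nu> \<noteq> Suc e \<Longrightarrow> a \<nu> = 0" for \<nu> using hom d by simp
  note Da = partial_deriv_homogeneous[of e a, OF hom']
  have Dg: "partial_deriv i (xmonom \<nu>\<^sub>0) \<mu> = 0" if "mdeg \<mu> < 2 * d - n - 1" for i \<mu>
    using that \<nu>0(1) by (auto simp: partial_deriv_def xmonom_def mdeg_add)
  have split: "mpowser_mult p (partial_deriv i (\<lambda>\<nu>. a \<nu> + xmonom \<nu>\<^sub>0 \<nu>)) \<nu> =
      mpowser_mult p (partial_deriv i a) \<nu> + mpowser_mult p (partial_deriv i (xmonom \<nu>\<^sub>0)) \<nu>" for p i \<nu>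
    by (simp add: mpowser_mult_def partial_deriv_def case_prod_unfold algebra_simps sum.distrib)
  have nondeg: "x = 0" if "\<And>i. part_value e (partial_deriv i a) x = 0" for x
    by (rule isolated_singularity_nondegenerate[OF hom' iso that])
  \<comment> \<open>If all \<open>b i\<close> have order at least \<open>p\<close>, the derivatives of the monomial do not interfere below degree \<open>p + (2 * d - n - 1)\<close>.\<close>
  have graded: "(\<Sum>i\<in>UNIV. mpowser_mult (b i) (partial_deriv i a) \<nu>) = xmonom \<nu>\<^sub>0 \<nu>"
    if "\<And>i \<mu>. mdeg \<mu> < p \<Longrightarrow> b i \<mu> = 0" "mdeg \<nu> < p + (2 * d - n - 1)" "mdeg \<nu> \<le> 2 * d - n" for p \<nu>
  proof -
    have "mpowser_mult (b i) (partial_deriv i (xmonom \<nu>\<^sub>0)) \<nu> = 0" for i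
      by (rule mpowser_mult_below_order[of p _ "2 * d - n - 1"]) (use that Dg in auto)
    with comb[OF that(3)] show ?thesis by (simp add: split)
  qed
  have relation: "(\<Sum>i\<in>UNIV. part_value e (partial_deriv i a) x * part_value k (b i) x) = 0"
    if "\<And>i \<mu>. mdeg \<mu> < k \<Longrightarrow> b i \<mu> = 0" "k \<le> 1" for k x
  proof -
    have "(\<Sum>i\<in>UNIV. part_value e (partial_deriv i a) x * part_value k (b i) x) =
          (\<Sum>i\<in>UNIV. part_value (k + e) (mpowser_mult (b i) (partial_deriv i a)) x)"
      by (simp add: part_value_mpowser_mult Da mult.commute)
    also have "\<dots> = (\<Sum>\<nu>\<in>monomials (k + e). (\<Sum>i\<in>UNIV. mpowser_mult (b i) (partial_deriv i a) \<nu>) * monomial_value x \<nu>)"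
      unfolding part_value_def sum_distrib_right by (rule sum.swap)
    also have "\<dots> = (\<Sum>\<nu>\<in>monomials (k + e). xmonom \<nu>\<^sub>0 \<nu> * monomial_value x \<nu>)"
      by (intro sum.cong arg_cong2[of _ _ _ _ "(*)"] graded[of k] that(1)) (use n d that(2) in auto)
    also have "\<dots> = 0"
      by (rule sum.neutral) (use \<nu>0(1) n d that(2) in \<open>auto simp: xmonom_def\<close>)
    finally show ?thesis .
  qed
  have b0: "b i 0 = 0" for i
  proof (rule constant_annihilator_eq_0[OF d(2), of a "\<lambda>i. b i 0"])
    show "(\<Sum>i\<in>UNIV. part_value e (partial_deriv i a) x * b i 0) = 0" for x
      using relation[of 0 x] by (simp add: part_value_degree_0)
  qed (rule nondeg)
  have low1: "mdeg \<mu> < 1 \<Longrightarrow> b i \<mu> = 0" for i \<mu>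
    using b0 by (simp add: mdeg_eq_0_iff)
  define A where "A = (\<chi> i j. b i (axis j 1))"
  have "A = 0"
  proof (rule linear_annihilator_eq_0[OF d(2), of a])
    show "(\<Sum>i\<in>UNIV. part_value e (partial_deriv i a) x * (\<Sum>j\<in>UNIV. A $ i $ j * x $ j)) = 0" for x
      using relation[of 1 x, OF low1] by (simp add: part_value_degree_1 A_def del: One_nat_def)
  qed (rule nondeg)
  hence b1: "b i (axis j 1) = 0" for i j by (simp add: A_def vec_eq_iff)
  have low2: "b i \<mu> = 0" if "mdeg \<mu> < 2" for i \<mu>
  proof (cases "mdeg \<mu> < 1")
    case False
    with that have "\<mu> \<in> monomials 1" by simp
    with b1 show ?thesis by (auto simp only: monomials_1)
  qed (rule low1)
  have deg: "2 * d - n = (d - n + 1) + e" using n d by simp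
  have "\<phi> \<nu>\<^sub>0 = (\<Sum>\<nu>\<in>monomials (2 * d - n). \<phi> \<nu> * xmonom \<nu>\<^sub>0 \<nu>)"
    using \<nu>0(1) by (simp add: xmonom_def finite_monomials if_distrib[of "\<lambda>c. _ * c"] sum.delta cong: if_cong)
  also have "\<dots> = (\<Sum>\<nu>\<in>monomials (2 * d - n). \<phi> \<nu> * (\<Sum>i\<in>UNIV. mpowser_mult (b i) (partial_deriv i a) \<nu>))"
    by (intro sum.cong arg_cong2[of _ _ _ _ "(*)"] graded[of 2, symmetric] low2) (use n in auto)
  also have "\<dots> = (\<Sum>i\<in>UNIV. \<Sum>\<nu>\<in>monomials (2 * d - n). \<phi> \<nu> * mpowser_mult (b i) (partial_deriv i a) \<nu>)"
    unfolding sum_distrib_left by (rule sum.swap)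
  also have "\<dots> = (\<Sum>i\<in>UNIV. \<Sum>\<mu>\<in>monomials (d - n + 1). \<Sum>\<kappa>\<in>monomials e. \<phi> (\<mu> + \<kappa>) * (b i \<mu> * partial_deriv i a \<kappa>))"
    unfolding deg by (intro sum.cong refl pairing_mpowser_mult Da)
  also have "\<dots> = (\<Sum>i\<in>UNIV. \<Sum>\<mu>\<in>monomials (d - n + 1). b i \<mu> * (\<Sum>\<kappa>\<in>monomials (d - 1). \<phi> (\<mu> + \<kappa>) * partial_deriv i a \<kappa>))"
    by (simp add: sum_distrib_left mult_ac e_def)
  also have "\<dots> = 0" by (intro sum.neutral ballI, subst \<phi>) auto
  finally show False using \<nu>0(2) by simp
qed

section \<open>Vanishing in the graded quotient\<close>

lemma Gr_V_image_in_carrier: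
  "g \<in> V w \<gamma> \<Longrightarrow> Gr_V_image w f \<gamma> g \<in> carrier (Gr_V w f \<gamma>)"
  by (auto simp: Gr_V_image_def Gr_V_def FactGroup_def RCOSETS_def VQ_group_def VQ_def)

text \<open>
  The unit of a quotient group is the subgroup itself, here \<open>V\<^sup>>\<^sup>\<gamma>\<close>. It contains zero, so the coset of
  the class of \<open>g\<close> can only equal it if the class of \<open>g\<close> lies in it.
\<close>

lemma Gr_V_image_eq_one:
  fixes g :: "('n::finite) mpowser"
  assumes one: "Gr_V_image w f \<gamma> g = \<one>\<^bsub>Gr_V w f \<gamma>\<^esub>"
    and g: "convergent_mpowser g" and D: "\<And>i. convergent_mpowser (partial_deriv i f)"
  obtains \<beta> v j where "\<beta> > \<gamma>" "v \<in> V w \<beta>" "j \<in> jacobian_ideal f" "\<And>\<nu>. g \<nu> = j \<nu> + v \<nu>"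
proof -
  interpret R: cring "\<C>{x} :: ('n mpowser) ring" by (rule cring_conv_mpowser_ring)
  interpret J: ideal "jacobian_ideal f" "\<C>{x} :: ('n mpowser) ring"
    unfolding jacobian_ideal_def by (rule R.genideal_ideal) (auto simp: D)
  interpret Q: ring "jacobian_ring f" by (rule J.quotient_is_ring)
  have zero_V: "(\<lambda>\<nu>. 0) \<in> V w (\<gamma> + 1)"
  proof -
    interpret I: ideal "V w (\<gamma> + 1)" "\<C>{x} :: ('n mpowser) ring"
      unfolding V_def by (rule R.genideal_ideal) (auto simp: convergent_xmonom)
    show ?thesis using I.zero_closed by simp
  qed
  have closed: "jacobian_class f p \<in> carrier (jacobian_ring f)" if "convergent_mpowser p" for p
    using that by (auto simp: jacobian_class_def FactRing_def A_RCOSETS_def' intro!: bexI[of _ p])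
  have "jacobian_class f (\<lambda>\<nu>. 0) = \<zero>\<^bsub>jacobian_ring f\<^esub>"
    using R.a_coset_add_zero[OF J.a_subset] by (simp add: jacobian_class_def FactRing_def)
  moreover have "jacobian_class f (\<lambda>\<nu>. 0) \<in> VQ_gt w f \<gamma>"
    using zero_V by (auto simp: VQ_gt_def VQ_def intro!: bexI[of _ "\<gamma> + 1"])
  ultimately have "\<zero>\<^bsub>jacobian_ring f\<^esub> \<in> VQ_gt w f \<gamma>" by simp
  hence "\<zero>\<^bsub>jacobian_ring f\<^esub> \<oplus>\<^bsub>jacobian_ring f\<^esub> jacobian_class f g \<in> Gr_V_image w f \<gamma> g"
    by (auto simp: Gr_V_image_def r_coset_def VQ_group_def)
  hence "jacobian_class f g \<in> Gr_V_image w f \<gamma> g"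
    using Q.l_zero[OF closed[OF g]] by simp
  also have "Gr_V_image w f \<gamma> g = VQ_gt w f \<gamma>" by (simp add: one Gr_V_def FactGroup_def)
  finally obtain \<beta> v where v: "\<beta> > \<gamma>" "v \<in> V w \<beta>" "jacobian_class f g = jacobian_class f v"
    by (auto simp: VQ_gt_def VQ_def)
  have "g \<in> jacobian_class f g"
    unfolding jacobian_class_def using J.a_rcos_self[of g] g by simp
  hence "g \<in> jacobian_class f v" by (simp only: v(3))
  then obtain j where "j \<in> jacobian_ideal f" "g = j \<oplus>\<^bsub>\<C>{x}\<^esub> v"
    by (auto simp: jacobian_class_def a_r_coset_def')
  with that v(1,2) show thesis by simp
qed

section \<open>The corollary\<close>

theorem corollary1:
  fixes f\<^sub>1 :: "(nat ^ 'n::finite) \<Rightarrow>\<^sub>0 complex"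
    and d n :: nat
    and w :: "'n \<Rightarrow> rat"
    and \<alpha> \<alpha>\<^sub>f :: rat
  assumes "n = CARD('n)" and "d > n" and "n \<ge> 3"
    and "homogeneous d f\<^sub>1"
    and "isolated_singularity_at_origin (Poly_Mapping.lookup f\<^sub>1)"
    and "\<And>i. w i = 1 / of_nat d"
    and "\<alpha>\<^sub>f = of_nat n / of_nat d"
    and "\<alpha> = 1"
  shows "(\<exists>\<nu>. mdeg \<nu> = 2 * d - n + 1 \<and>
           (let \<rho> = wdeg w \<nu> in
              \<rho> = (2 * of_nat d - of_nat n + 1) / of_nat d \<and> \<rho> > 1 \<and>
              \<alpha> < \<alpha>\<^sub>f + \<rho> - 1)) \<and>
         (\<exists>\<nu>. mdeg \<nu> = 2 * d - n \<and>
           (let g = xmonom \<nu>; f = Poly_Mapping.lookup f\<^sub>1 \<oplus>\<^bsub>\<C>{x}\<^esub> g; \<rho> = wdeg w \<nu>; r = (1::nat) in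
              \<rho> = (2 * of_nat d - of_nat n) / of_nat d \<and> \<rho> > 1 \<and>
              (\<exists>h \<in> V w (\<alpha> + of_nat r - of_nat r * \<rho>).
                 let u = Gr_V_image w f (\<alpha> + of_nat r) ((g [^]\<^bsub>\<C>{x}\<^esub> r) \<otimes>\<^bsub>\<C>{x}\<^esub> h) in
                 u \<in> carrier (Gr_V w f (\<alpha> + of_nat r)) \<and>
                 u \<noteq> \<one>\<^bsub>Gr_V w f (\<alpha> + of_nat r)\<^esub>)))"
proof (intro conjI)
  have wdeg_eq: "wdeg w \<nu> = of_nat (mdeg \<nu>) / of_nat d" for \<nu>
    by (simp add: wdeg_def mdeg_def assms(6) sum_divide_distrib)
  have shifted_eq: "shifted_wdeg w \<nu> = (of_nat (mdeg \<nu>) + of_nat n) / of_nat d" for \<nu>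
    by (simp add: shifted_wdeg_def mdeg_def assms(1,6) sum.distrib sum_divide_distrib[symmetric])
  have d: "d > 0" and nd: "n \<le> 2 * d" using assms(2,3) by auto
  have nd': "of_nat n < (of_nat d :: rat)" using assms(2) by simp
  show "\<exists>\<nu>. mdeg \<nu> = 2 * d - n + 1 \<and>
           (let \<rho> = wdeg w \<nu> in
              \<rho> = (2 * of_nat d - of_nat n + 1) / of_nat d \<and> \<rho> > 1 \<and>
              \<alpha> < \<alpha>\<^sub>f + \<rho> - 1)"
    using d nd nd' assms(7,8)
    by (intro exI[of _ "axis undefined (2 * d - n + 1)"])
       (auto simp: Let_def wdeg_eq of_nat_diff field_simps)
  define a where "a = Poly_Mapping.lookup f\<^sub>1"
  have hom: "a \<nu> = 0" if "mdeg \<nu> \<noteq> d" for \<nu>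
    using assms(4) that by (auto simp: homogeneous_def a_def in_keys_iff)
  obtain \<phi> \<nu>\<^sub>0 where \<nu>0: "mdeg \<nu>\<^sub>0 = 2 * d - n" "\<phi> \<nu>\<^sub>0 \<noteq> 0"
    and \<phi>: "\<And>i \<mu>. mdeg \<mu> = d - n + 1 \<Longrightarrow>
      (\<Sum>\<kappa>\<in>monomials (d - 1). \<phi> (\<mu> + \<kappa>) * partial_deriv i a \<kappa>) = 0"
    by (rule functional_vanishing_on_multiples[OF assms(1,3,2), of "\<lambda>i. partial_deriv i a"]) (rule that)
  define g where "g = xmonom \<nu>\<^sub>0"
  define f where "f = (\<lambda>\<nu>. a \<nu> + g \<nu>)"
  have rho: "wdeg w \<nu>\<^sub>0 = (2 * of_nat d - of_nat n) / of_nat d"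
    using nd by (simp add: wdeg_eq \<nu>0 of_nat_diff)
  have rho_gt: "wdeg w \<nu>\<^sub>0 > 1" using d nd' by (simp add: rho field_simps)
  have level: "\<alpha> + of_nat 1 - of_nat 1 * wdeg w \<nu>\<^sub>0 = of_nat n / of_nat d"
    using d by (simp add: rho assms(8) field_simps)
  \<comment> \<open>The level required of \<open>h\<close> is the smallest one, that of the monomial \<open>1\<close>; so \<open>h = 1\<close> is admissible.\<close>
  have h: "xmonom 0 \<in> V w (\<alpha> + of_nat 1 - of_nat 1 * wdeg w \<nu>\<^sub>0)"
    unfolding level by (rule V_memI) (simp add: shifted_eq)
  have g_level: "g \<in> V w (\<alpha> + of_nat 1)"
    unfolding g_def by (rule V_memI) (use d nd in \<open>simp add: shifted_eq \<nu>0 assms(8) of_nat_diff\<close>)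
  have prod: "(g [^]\<^bsub>\<C>{x}\<^esub> (1::nat)) \<otimes>\<^bsub>\<C>{x}\<^esub> xmonom 0 = g"
    by (simp add: nat_pow_def conv_mpowser_ring_def mpowser_mult_xmonom_0 mpowser_mult_commute[of _ "xmonom 0"])
  have nonzero: "Gr_V_image w f (\<alpha> + of_nat 1) g \<noteq> \<one>\<^bsub>Gr_V w f (\<alpha> + of_nat 1)\<^esub>"
  proof
    assume one: "Gr_V_image w f (\<alpha> + of_nat 1) g = \<one>\<^bsub>Gr_V w f (\<alpha> + of_nat 1)\<^esub>"
    have D: "convergent_mpowser (partial_deriv i f)" for i
    proof (rule convergent_mpowser_finite_support, rule finite_subset)
      show "{\<nu>. partial_deriv i f \<nu> \<noteq> 0} \<subseteq> monomials (d - 1) \<union> monomials (2 * d - n - 1)"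
      proof
        fix \<nu> assume "\<nu> \<in> {\<nu>. partial_deriv i f \<nu> \<noteq> 0}"
        hence "a (\<nu> + axis i 1) \<noteq> 0 \<or> g (\<nu> + axis i 1) \<noteq> 0"
          by (auto simp: partial_deriv_def f_def)
        hence "mdeg (\<nu> + axis i 1) = d \<or> mdeg (\<nu> + axis i 1) = 2 * d - n"
          using hom[of "\<nu> + axis i 1"] \<nu>0(1) by (auto simp: g_def xmonom_def split: if_splits)
        thus "\<nu> \<in> monomials (d - 1) \<union> monomials (2 * d - n - 1)" by (auto simp: mdeg_add)
      qed
    qed (simp add: finite_monomials)
    obtain \<beta> v j where \<beta>: "\<beta> > \<alpha> + of_nat 1" "v \<in> V w \<beta>"
      and j: "j \<in> jacobian_ideal f" and eq: "\<And>\<nu>. g \<nu> = j \<nu> + v \<nu>"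
      using Gr_V_image_eq_one[OF one _ D] convergent_xmonom unfolding g_def by blast
    obtain b where b: "j = (\<lambda>\<nu>. \<Sum>i\<in>UNIV. mpowser_mult (b i) (partial_deriv i f) \<nu>)"
      by (rule jacobian_ideal_combination[OF j D])
    have "(\<Sum>i\<in>UNIV. mpowser_mult (b i) (partial_deriv i f) \<nu>) = g \<nu>" if "mdeg \<nu> \<le> 2 * d - n" for \<nu>
    proof -
      have "shifted_wdeg w \<mu> < \<beta>" if "mdeg \<mu> \<le> 2 * d - n" for \<mu>
      proof -
        have "mdeg \<mu> + n \<le> 2 * d" using that nd by simp
        hence "of_nat (mdeg \<mu>) + of_nat n \<le> (2 * of_nat d :: rat)"
          by (metis of_nat_add of_nat_le_iff of_nat_mult of_nat_numeral)
        hence "shifted_wdeg w \<mu> \<le> 2" using d by (simp add: shifted_eq field_simps)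
        with \<beta>(1) show ?thesis by (simp add: assms(8))
      qed
      hence "v \<nu> = 0" by (rule V_coeff_eq_0[OF \<beta>(2) _ that])
      with eq[of \<nu>] show ?thesis by (simp add: b)
    qed
    thus False
      using jacobian_combination_not_leading[OF assms(1,3,2) hom _ \<nu>0 \<phi>, of b]
        assms(5) by (simp add: f_def g_def a_def)
  qed
  show "\<exists>\<nu>. mdeg \<nu> = 2 * d - n \<and>
           (let g = xmonom \<nu>; f = Poly_Mapping.lookup f\<^sub>1 \<oplus>\<^bsub>\<C>{x}\<^esub> g; \<rho> = wdeg w \<nu>; r = (1::nat) in
              \<rho> = (2 * of_nat d - of_nat n) / of_nat d \<and> \<rho> > 1 \<and>
              (\<exists>h \<in> V w (\<alpha> + of_nat r - of_nat r * \<rho>).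
                 let u = Gr_V_image w f (\<alpha> + of_nat r) ((g [^]\<^bsub>\<C>{x}\<^esub> r) \<otimes>\<^bsub>\<C>{x}\<^esub> h) in
                 u \<in> carrier (Gr_V w f (\<alpha> + of_nat r)) \<and>
                 u \<noteq> \<one>\<^bsub>Gr_V w f (\<alpha> + of_nat r)\<^esub>))"
    unfolding Let_def
  proof (intro exI[of _ \<nu>\<^sub>0] conjI bexI[OF _ h])
    have f_eq: "Poly_Mapping.lookup f\<^sub>1 \<oplus>\<^bsub>\<C>{x}\<^esub> xmonom \<nu>\<^sub>0 = f"
      by (simp add: f_def g_def a_def)
    show "Gr_V_image w (Poly_Mapping.lookup f\<^sub>1 \<oplus>\<^bsub>\<C>{x}\<^esub> xmonom \<nu>\<^sub>0) (\<alpha> + of_nat 1)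
        ((xmonom \<nu>\<^sub>0 [^]\<^bsub>\<C>{x}\<^esub> (1::nat)) \<otimes>\<^bsub>\<C>{x}\<^esub> xmonom 0)
      \<in> carrier (Gr_V w (Poly_Mapping.lookup f\<^sub>1 \<oplus>\<^bsub>\<C>{x}\<^esub> xmonom \<nu>\<^sub>0) (\<alpha> + of_nat 1))"
      unfolding f_eq prod[unfolded g_def] by (rule Gr_V_image_in_carrier[OF g_level[unfolded g_def]])
    show "Gr_V_image w (Poly_Mapping.lookup f\<^sub>1 \<oplus>\<^bsub>\<C>{x}\<^esub> xmonom \<nu>\<^sub>0) (\<alpha> + of_nat 1)
        ((xmonom \<nu>\<^sub>0 [^]\<^bsub>\<C>{x}\<^esub> (1::nat)) \<otimes>\<^bsub>\<C>{x}\<^esub> xmonom 0)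
      \<noteq> \<one>\<^bsub>Gr_V w (Poly_Mapping.lookup f\<^sub>1 \<oplus>\<^bsub>\<C>{x}\<^esub> xmonom \<nu>\<^sub>0) (\<alpha> + of_nat 1)\<^esub>"
      unfolding f_eq prod[unfolded g_def] by (rule nonzero[unfolded g_def])
  qed (use \<nu>0 rho rho_gt in auto)
qed

end
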